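(* Let $(M,\langle\cdot,\cdot\rangle)$ be a closed Riemannian 3-manifold and let $k$ be a smooth, globally defined unit vector field on $M$ with geodesic flow, i.e. $\nabla_k k=0$. If $\mathrm{Ric}(k,k)>0$ (everywhere on $M$), then $k$ is not hypersurface-orthogonal at any point of $M$.
   Context: Closed means compact without boundary; $\nabla$ is the Levi-Civita connection. For a smooth unit vector field $k$ and a point $q$, choose a local orthonormal frame $\{k,x,y\}$ near $q$. The rotation of $k$ is $\omega=\langle\nabla_y k,x\rangle-\langle\nabla_x k,y\rangle$, which is independent of the choice of $x,y$ up to sign. The vector field $k$ is called hypersurface-orthogonal at $q$ if $\omega(q)=0$ (equivalently $\langle k,[x,y]\rangle|_q=0$). The sign convention for $\mathrm{Ric}$ is the standard one, in which round spheres have positive Ricci curvature. *)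

theory Defs
  imports "HOL-Analysis.Analysis"
begin

section \<open>Smooth maps and manifolds\<close>

text \<open>Only meaningful on open sets and, for the identification with the usual
  \<open>C\<^sup>n\<close>, on a finite-dimensional domain: the derivative is taken in each fixed
  direction \<open>v\<close>, and each directional derivative is required to be \<open>C\<^sup>n\<close> again.\<close>

primrec Ck_on :: "nat \<Rightarrow> 'a::real_normed_vector set \<Rightarrow> ('a \<Rightarrow> 'b::real_normed_vector) \<Rightarrow> bool" where
  "Ck_on 0 S f \<longleftrightarrow> continuous_on S f"
| "Ck_on (Suc n) S f \<longleftrightarrow> (\<forall>x\<in>S. f differentiable (at x)) \<and>
     (\<forall>v. Ck_on n S (\<lambda>x. frechet_derivative f (at x) v))"

definition smooth_on :: "'a::real_normed_vector set \<Rightarrow> ('a \<Rightarrow> 'b::real_normed_vector) \<Rightarrow> bool" where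
  "smooth_on S f \<longleftrightarrow> (\<forall>n. Ck_on n S f)"

text \<open>A chart is a pair of its domain and its coordinate map.\<close>

type_synonym ('m, 'n) chart = "'m set \<times> ('m \<Rightarrow> real ^ 'n)"

abbreviation cdom :: "('m, 'n) chart \<Rightarrow> 'm set" where
  "cdom c \<equiv> fst c"

abbreviation coord :: "('m, 'n) chart \<Rightarrow> 'm \<Rightarrow> real ^ 'n" where
  "coord c \<equiv> snd c"

abbreviation crange :: "('m, 'n) chart \<Rightarrow> (real ^ 'n) set" where
  "crange c \<equiv> coord c ` cdom c"

definition chart_on :: "'m topology \<Rightarrow> ('m, 'n::finite) chart \<Rightarrow> bool" where
  "chart_on M c \<longleftrightarrow> openin M (cdom c) \<and> open (crange c) \<and>
     homeomorphic_map (subtopology M (cdom c)) (top_of_set (crange c)) (coord c)"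

definition transition :: "('m, 'n) chart \<Rightarrow> ('m, 'n) chart \<Rightarrow> real ^ 'n \<Rightarrow> real ^ 'n" where
  "transition c c' = coord c' \<circ> inv_into (cdom c) (coord c)"

definition smooth_atlas :: "'m topology \<Rightarrow> ('m, 'n::finite) chart set \<Rightarrow> bool" where
  "smooth_atlas M A \<longleftrightarrow>
     (\<forall>c\<in>A. chart_on M c) \<and>
     (\<Union>c\<in>A. cdom c) = topspace M \<and>
     (\<forall>c\<in>A. \<forall>c'\<in>A. smooth_on (coord c ` (cdom c \<inter> cdom c')) (transition c c'))"

text \<open>A closed manifold of dimension \<open>CARD('n)\<close>; there is no boundary because all chart
  ranges are open in Euclidean space. Connectedness is not assumed.\<close>

definition closed_smooth_manifold :: "'m topology \<Rightarrow> ('m, 'n::finite) chart set \<Rightarrow> bool" where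
  "closed_smooth_manifold M A \<longleftrightarrow>
     Hausdorff_space M \<and> second_countable M \<and> compact_space M \<and> smooth_atlas M A"

section \<open>Vector fields and Riemannian metrics\<close>

text \<open>Tensor fields are given by their components in every chart \<open>c\<close>, as functions on the
  range of \<open>c\<close>, subject to the tensor transformation law on overlaps.\<close>

definition smooth_vector_field ::
    "('m, 'n::finite) chart set \<Rightarrow> (('m, 'n) chart \<Rightarrow> real ^ 'n \<Rightarrow> real ^ 'n) \<Rightarrow> bool" where
  "smooth_vector_field A X \<longleftrightarrow>
     (\<forall>c\<in>A. smooth_on (crange c) (X c)) \<and>
     (\<forall>c\<in>A. \<forall>c'\<in>A. \<forall>p \<in> cdom c \<inter> cdom c'.
        X c' (coord c' p) =
          frechet_derivative (transition c c') (at (coord c p)) (X c (coord c p)))"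

definition mip :: "real ^ 'n ^ 'n \<Rightarrow> real ^ 'n \<Rightarrow> real ^ 'n \<Rightarrow> real" where
  "mip G v w = v \<bullet> (G *v w)"

definition riemannian_metric ::
    "('m, 'n::finite) chart set \<Rightarrow> (('m, 'n) chart \<Rightarrow> real ^ 'n \<Rightarrow> real ^ 'n ^ 'n) \<Rightarrow> bool" where
  "riemannian_metric A g \<longleftrightarrow>
     (\<forall>c\<in>A. smooth_on (crange c) (g c)) \<and>
     (\<forall>c\<in>A. \<forall>x\<in>crange c. transpose (g c x) = g c x \<and> (\<forall>v. v \<noteq> 0 \<longrightarrow> mip (g c x) v v > 0)) \<and>
     (\<forall>c\<in>A. \<forall>c'\<in>A. \<forall>p \<in> cdom c \<inter> cdom c'. \<forall>v w.
        mip (g c (coord c p)) v w =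
          mip (g c' (coord c' p))
            (frechet_derivative (transition c c') (at (coord c p)) v)
            (frechet_derivative (transition c c') (at (coord c p)) w))"

section \<open>Levi-Civita connection and curvature in a chart\<close>

definition pd :: "'n::finite \<Rightarrow> (real ^ 'n \<Rightarrow> real) \<Rightarrow> real ^ 'n \<Rightarrow> real" where
  "pd i f x = frechet_derivative f (at x) (axis i 1)"

text \<open>\<open>christoffel G x i j l\<close> is \<open>\<Gamma>\<^sup>l\<^sub>i\<^sub>j\<close> at \<open>x\<close>.\<close>

definition christoffel ::
    "(real ^ 'n \<Rightarrow> real ^ 'n ^ 'n) \<Rightarrow> real ^ 'n \<Rightarrow> 'n::finite \<Rightarrow> 'n \<Rightarrow> 'n \<Rightarrow> real" where
  "christoffel G x i j l =
     (1/2) * (\<Sum>m\<in>UNIV. matrix_inv (G x) $ l $ m *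
        (pd i (\<lambda>z. G z $ j $ m) x + pd j (\<lambda>z. G z $ i $ m) x - pd m (\<lambda>z. G z $ i $ j) x))"

text \<open>\<open>covd \<Gamma> X Y\<close> is \<open>\<nabla>\<^sub>X Y\<close> for the affine connection with coefficients \<open>\<Gamma>\<close>.\<close>

definition covd ::
    "(real ^ 'n \<Rightarrow> 'n::finite \<Rightarrow> 'n \<Rightarrow> 'n \<Rightarrow> real) \<Rightarrow>
     (real ^ 'n \<Rightarrow> real ^ 'n) \<Rightarrow> (real ^ 'n \<Rightarrow> real ^ 'n) \<Rightarrow> real ^ 'n \<Rightarrow> real ^ 'n" where
  "covd \<Gamma> X Y x = frechet_derivative Y (at x) (X x) +
     (\<chi> l. \<Sum>i\<in>UNIV. \<Sum>j\<in>UNIV. \<Gamma> x i j l * X x $ i * Y x $ j)"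

definition nabla ::
    "(real ^ 'n \<Rightarrow> real ^ 'n ^ 'n::finite) \<Rightarrow>
     (real ^ 'n \<Rightarrow> real ^ 'n) \<Rightarrow> (real ^ 'n \<Rightarrow> real ^ 'n) \<Rightarrow> real ^ 'n \<Rightarrow> real ^ 'n" where
  "nabla G = covd (christoffel G)"

definition lie_bracket ::
    "(real ^ 'n \<Rightarrow> real ^ 'n) \<Rightarrow> (real ^ 'n \<Rightarrow> real ^ 'n) \<Rightarrow> real ^ 'n \<Rightarrow> real ^ 'n" where
  "lie_bracket X Y x = frechet_derivative Y (at x) (X x) - frechet_derivative X (at x) (Y x)"

definition riemann ::
    "(real ^ 'n \<Rightarrow> real ^ 'n ^ 'n::finite) \<Rightarrow> (real ^ 'n \<Rightarrow> real ^ 'n) \<Rightarrow>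
     (real ^ 'n \<Rightarrow> real ^ 'n) \<Rightarrow> (real ^ 'n \<Rightarrow> real ^ 'n) \<Rightarrow> real ^ 'n \<Rightarrow> real ^ 'n" where
  "riemann G X Y Z x =
     nabla G X (nabla G Y Z) x - nabla G Y (nabla G X Z) x - nabla G (lie_bracket X Y) Z x"

text \<open>\<open>Ric(Y,Z)\<close> is the trace of \<open>X \<mapsto> R(X,Y)Z\<close>, computed in the coordinate frame; with
  the sign of \<^const>\<open>riemann\<close> above, round spheres have positive Ricci curvature.\<close>

definition ricci ::
    "(real ^ 'n \<Rightarrow> real ^ 'n ^ 'n::finite) \<Rightarrow>
     (real ^ 'n \<Rightarrow> real ^ 'n) \<Rightarrow> (real ^ 'n \<Rightarrow> real ^ 'n) \<Rightarrow> real ^ 'n \<Rightarrow> real" where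
  "ricci G Y Z x = (\<Sum>i\<in>UNIV. riemann G (\<lambda>_. axis i 1) Y Z x $ i)"

text \<open>At a point where the metric is differentiable, symmetric and nondegenerate, the
  Christoffel connection is torsion-free and metric, and it is the only such connection.\<close>

lemma pd_symmetric:
  assumes "\<And>z. z \<in> S \<Longrightarrow> transpose (G z) = G z" and "open S" and "x \<in> S"
  shows "pd m (\<lambda>z. (G z :: real^'n^'n) $ i $ j) x = pd m (\<lambda>z. G z $ j $ i) (x :: real ^ 'n::finite)"
proof -
  have sw: "G z $ i $ j = G z $ j $ i" if "z \<in> S" for z
    using assms(1)[OF that] by (metis (no_types) transpose_def vec_lambda_beta)
  have "((\<lambda>z. G z $ i $ j) has_derivative f) (at x) \<longleftrightarrow> ((\<lambda>z. G z $ j $ i) has_derivative f) (at x)" for f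
    using has_derivative_transform_within_open[OF _ assms(2,3)] sw by (metis (no_types, lifting))
  then show ?thesis
    unfolding pd_def frechet_derivative_def by simp
qed

lemma christoffel_symmetric:
  assumes "\<And>z. z \<in> S \<Longrightarrow> transpose (G z) = G z" and "open S" and "x \<in> S"
  shows "christoffel G x i j l = christoffel G x j i l"
  unfolding christoffel_def
  using pd_symmetric[where G = G, OF assms, of _ i j] by (simp add: add.commute)

lemma nabla_torsion_free:
  assumes "\<And>z. z \<in> S \<Longrightarrow> transpose (G z) = G z" and "open S" and "x \<in> S"
  shows "nabla G X Y x - nabla G Y X x = lie_bracket X Y x"
proof -
  have "(\<Sum>i\<in>UNIV. \<Sum>j\<in>UNIV. christoffel G x i j l * X x $ i * Y x $ j) =
        (\<Sum>i\<in>UNIV. \<Sum>j\<in>UNIV. christoffel G x i j l * Y x $ i * X x $ j)" for l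
    by (subst sum.swap, intro sum.cong refl, subst christoffel_symmetric[where G = G, OF assms])
       (assumption | simp add: mult.commute mult.left_commute)+
  then show ?thesis
    by (simp add: nabla_def covd_def lie_bracket_def)
qed

lemma matrix_inv_both:
  fixes B :: "real ^ 'n::finite ^ 'n"
  assumes "invertible B"
  shows "B ** matrix_inv B = mat 1 \<and> matrix_inv B ** B = mat 1"
  using assms unfolding invertible_def matrix_inv_def by (rule someI_ex)

lemma christoffel_lower:
  assumes "invertible (G x)"
  shows "(\<Sum>l\<in>UNIV. G x $ m $ l * christoffel G x i j l) =
    (1/2) * (pd i (\<lambda>z. G z $ j $ m) x + pd j (\<lambda>z. G z $ i $ m) x - pd m (\<lambda>z. G z $ i $ j) x)"
proof -
  define b where "b = (\<chi> m. (1/2) * (pd i (\<lambda>z. G z $ j $ m) x + pd j (\<lambda>z. G z $ i $ m) x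
     - pd m (\<lambda>z. G z $ i $ j) x))"
  have "(\<chi> l. christoffel G x i j l) = matrix_inv (G x) *v b"
    by (simp add: vec_eq_iff christoffel_def b_def matrix_vector_mult_def sum_distrib_left
        mult.assoc mult.left_commute)
  then have "G x *v (\<chi> l. christoffel G x i j l) = b"
    using assms by (simp add: matrix_vector_mul_assoc matrix_inv_both)
  then have "(G x *v (\<chi> l. christoffel G x i j l)) $ m = b $ m" by simp
  then show ?thesis by (simp add: matrix_vector_mult_def b_def)
qed

lemma christoffel_metric:
  assumes "\<And>z. z \<in> S \<Longrightarrow> transpose (G z) = G z" and "open S" and "x \<in> S" and "invertible (G x)"
  shows "pd m (\<lambda>z. G z $ i $ j) x =
    (\<Sum>l\<in>UNIV. G x $ j $ l * christoffel G x m i l) + (\<Sum>l\<in>UNIV. G x $ i $ l * christoffel G x m j l)"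
  using pd_symmetric[where G = G, OF assms(1-3)]
  unfolding christoffel_lower[of G x, OF assms(4)] by (simp add: field_simps)

lemma christoffel_unique:
  assumes "\<And>z. z \<in> S \<Longrightarrow> transpose (G z) = G z" and "open S" and "x \<in> S" and inv: "invertible (G x)"
    and tf: "\<And>i j l. \<Gamma> i j l = \<Gamma> j i l"
    and metric: "\<And>m i j. pd m (\<lambda>z. G z $ i $ j) x =
      (\<Sum>l\<in>UNIV. G x $ j $ l * \<Gamma> m i l) + (\<Sum>l\<in>UNIV. G x $ i $ l * \<Gamma> m j l)"
  shows "\<Gamma> i j l = christoffel G x i j l"
proof -
  have "(\<Sum>l\<in>UNIV. G x $ m $ l * \<Gamma> i j l) = (\<Sum>l\<in>UNIV. G x $ m $ l * christoffel G x i j l)" for m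
    unfolding christoffel_lower[of G x, OF inv]
    using metric[of i j m] metric[of j i m] metric[of m i j] tf by simp
  then have "G x *v (\<chi> l. \<Gamma> i j l) = G x *v (\<chi> l. christoffel G x i j l)"
    by (simp add: vec_eq_iff matrix_vector_mult_def)
  then have "(\<chi> l. \<Gamma> i j l) = (\<chi> l. christoffel G x i j l)"
    using inv by (metis matrix_vector_mul_assoc matrix_inv_both matrix_vector_mul_lid)
  then show ?thesis by (simp add: vec_eq_iff)
qed

section \<open>Geodesic unit fields, rotation, hypersurface-orthogonality\<close>

definition unit_field ::
    "('m, 'n::finite) chart set \<Rightarrow> (('m, 'n) chart \<Rightarrow> real ^ 'n \<Rightarrow> real ^ 'n ^ 'n) \<Rightarrow>
     (('m, 'n) chart \<Rightarrow> real ^ 'n \<Rightarrow> real ^ 'n) \<Rightarrow> bool" where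
  "unit_field A g k \<longleftrightarrow> (\<forall>c\<in>A. \<forall>x\<in>crange c. mip (g c x) (k c x) (k c x) = 1)"

definition geodesic_field ::
    "('m, 'n::finite) chart set \<Rightarrow> (('m, 'n) chart \<Rightarrow> real ^ 'n \<Rightarrow> real ^ 'n ^ 'n) \<Rightarrow>
     (('m, 'n) chart \<Rightarrow> real ^ 'n \<Rightarrow> real ^ 'n) \<Rightarrow> bool" where
  "geodesic_field A g k \<longleftrightarrow> (\<forall>c\<in>A. \<forall>x\<in>crange c. nabla (g c) (k c) (k c) x = 0)"

definition local_orthonormal_frame ::
    "(real ^ 3 \<Rightarrow> real ^ 3 ^ 3) \<Rightarrow> (real ^ 3) set \<Rightarrow> (real ^ 3 \<Rightarrow> real ^ 3) \<Rightarrow>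
     (real ^ 3 \<Rightarrow> real ^ 3) \<Rightarrow> (real ^ 3 \<Rightarrow> real ^ 3) \<Rightarrow> bool" where
  "local_orthonormal_frame G V K X Y \<longleftrightarrow>
     smooth_on V K \<and> smooth_on V X \<and> smooth_on V Y \<and>
     (\<forall>z\<in>V. mip (G z) (K z) (K z) = 1 \<and> mip (G z) (X z) (X z) = 1 \<and> mip (G z) (Y z) (Y z) = 1 \<and>
            mip (G z) (K z) (X z) = 0 \<and> mip (G z) (K z) (Y z) = 0 \<and> mip (G z) (X z) (Y z) = 0)"

definition rotation ::
    "(real ^ 3 \<Rightarrow> real ^ 3 ^ 3) \<Rightarrow> (real ^ 3 \<Rightarrow> real ^ 3) \<Rightarrow>
     (real ^ 3 \<Rightarrow> real ^ 3) \<Rightarrow> (real ^ 3 \<Rightarrow> real ^ 3) \<Rightarrow> real ^ 3 \<Rightarrow> real" where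
  "rotation G K X Y z = mip (G z) (nabla G Y K z) (X z) - mip (G z) (nabla G X K z) (Y z)"

text \<open>The rotation depends on the frame only up to sign, so one may ask for its vanishing in
  some chart and some local frame around \<open>q\<close>.\<close>

definition hypersurface_orthogonal_at ::
    "('m, 3) chart set \<Rightarrow> (('m, 3) chart \<Rightarrow> real ^ 3 \<Rightarrow> real ^ 3 ^ 3) \<Rightarrow>
     (('m, 3) chart \<Rightarrow> real ^ 3 \<Rightarrow> real ^ 3) \<Rightarrow> 'm \<Rightarrow> bool" where
  "hypersurface_orthogonal_at A g k q \<longleftrightarrow>
     (\<exists>c\<in>A. q \<in> cdom c \<and>
       (\<exists>V X Y. open V \<and> coord c q \<in> V \<and> V \<subseteq> crange c \<and>
          local_orthonormal_frame (g c) V (k c) X Y \<and>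
          rotation (g c) (k c) X Y (coord c q) = 0))"

end

theory Submission
  imports Defs
begin

text \<open>Write \<open>B u = \<nabla>\<^sub>u k\<close>, let the expansion \<open>\<theta>\<close> be the trace of \<open>B\<close>, and let the vorticity be
  the 2-form \<open>\<Omega>(u, v) = \<langle>B u, v\<rangle> - \<langle>B v, u\<rangle>\<close>, the exterior derivative of the 1-form \<open>\<langle>k, \<cdot>\<rangle>\<close>.
  In dimension three \<open>\<Omega>\<close> vanishes at a point exactly when the rotation does, because \<open>\<Omega>(k, \<cdot>) = 0\<close>
  for a geodesic unit field. Three facts drive the proof.

  \<^item> Tracing the definition of curvature gives the Raychaudhuri equation
    \<open>k(\<theta>) = - Ric(k, k) - tr (B\<^sup>2)\<close> (\<open>raychaudhuri\<close>). Where \<open>\<Omega> = 0\<close> the endomorphism \<open>B\<close> is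
    self-adjoint, so \<open>tr (B\<^sup>2) \<ge> 0\<close> and \<open>\<theta>\<close> strictly decreases along \<open>k\<close>
    (\<open>expansion_decreasing\<close>).

  \<^item> Since \<open>\<Omega>\<close> is closed and \<open>\<Omega>(k, \<cdot>) = 0\<close>, its Lie derivative along \<open>k\<close> vanishes; in a chart,
    the derivative of \<open>\<Omega>\<close> along \<open>k\<close> is therefore linear in \<open>\<Omega>\<close> (\<open>D_vorticity\<close>). So the zero set
    \<open>Z\<close> of \<open>\<Omega>\<close> is invariant under the flow of \<open>k\<close>.

  \<^item> Both \<open>\<theta>\<close> and the vanishing of \<open>\<Omega>\<close> are independent of the chart (\<open>chart_change\<close>), so \<open>Z\<close> is a
    closed subset of the manifold and \<open>\<theta>\<close> is a continuous function on it.

  If the rotation vanished somewhere, \<open>Z\<close> would be nonempty and compact, and \<open>\<theta>\<close> would attain a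
  minimum over \<open>Z\<close> at some point. Moving along \<open>k\<close> from there stays in \<open>Z\<close> and decreases \<open>\<theta>\<close>, a
  contradiction.

  The last step is carried out without integral curves, by a penalty argument
  (\<open>constrained_minimum\<close>): in a small ball around the minimum point \<open>x\<^sub>0\<close>, minimise
  \<open>\<theta> + |x - x\<^sub>0|\<^sup>2 + n |\<Omega>|\<^sup>2\<close>. The minimisers converge to \<open>x\<^sub>0\<close> and the penalty terms tend to zero;
  by linearity the derivative of the penalty along \<open>k\<close> is bounded by a constant multiple of the
  penalty, so in the limit the derivative of \<open>\<theta>\<close> along \<open>k\<close> at \<open>x\<^sub>0\<close> is nonnegative.\<close>

section \<open>Calculus of smooth maps\<close>

abbreviation D :: "('a::real_normed_vector \<Rightarrow> 'b::real_normed_vector) \<Rightarrow> 'a \<Rightarrow> 'a \<Rightarrow> 'b" where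
  "D f x v \<equiv> frechet_derivative f (at x) v"

lemma D_eqI: "(f has_derivative f') (at x) \<Longrightarrow> D f x v = f' v"
  by (metis frechet_derivative_at)

lemma smooth_on_differentiable: "smooth_on S f \<Longrightarrow> x \<in> S \<Longrightarrow> f differentiable (at x)"
  unfolding smooth_on_def by (metis Ck_on.simps(2))

lemma smooth_on_has_derivative:
  "smooth_on S f \<Longrightarrow> x \<in> S \<Longrightarrow> (f has_derivative frechet_derivative f (at x)) (at x)"
  using frechet_derivative_works smooth_on_differentiable by blast

lemma smooth_on_continuous: "smooth_on S f \<Longrightarrow> continuous_on S f"
  unfolding smooth_on_def by (metis Ck_on.simps(1))

lemma smooth_on_D: "smooth_on S f \<Longrightarrow> smooth_on S (\<lambda>x. D f x v)"
  unfolding smooth_on_def by (metis Ck_on.simps(2))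

lemma Ck_on_Suc_imp: "Ck_on (Suc n) S f \<Longrightarrow> Ck_on n S f"
proof (induction n arbitrary: f)
  case 0
  then show ?case
    by (auto intro!: continuous_at_imp_continuous_on differentiable_imp_continuous_within)
next
  case (Suc n)
  then show ?case by (metis Ck_on.simps(2))
qed

lemma differentiable_transform_open:
  assumes "f differentiable (at x)" "open S" "x \<in> S" "\<And>y. y \<in> S \<Longrightarrow> f y = g y"
  shows "g differentiable (at x)"
  using assms has_derivative_transform_within_open[OF _ assms(2,3), of f _ UNIV g]
  unfolding differentiable_def by blast

lemma D_cong:
  assumes "open S" "x \<in> S" "\<And>y. y \<in> S \<Longrightarrow> f y = g y"
  shows "D f x v = D g x v"
proof -
  have "(f has_derivative F) (at x) \<longleftrightarrow> (g has_derivative F) (at x)" for F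
    using has_derivative_transform_within_open[OF _ assms(1,2), of f F UNIV g]
      has_derivative_transform_within_open[OF _ assms(1,2), of g F UNIV f] assms(3) by fastforce
  then show ?thesis unfolding frechet_derivative_def by simp
qed

lemma Ck_on_cong:
  assumes "open S" "\<And>x. x \<in> S \<Longrightarrow> f x = g x" "Ck_on n S f"
  shows "Ck_on n S g"
  using assms(2,3)
proof (induction n arbitrary: f g)
  case 0
  then show ?case by (simp cong: continuous_on_cong)
next
  case (Suc n)
  have "g differentiable (at x)" if "x \<in> S" for x
    using differentiable_transform_open[OF _ assms(1) that, of f g] Suc.prems that by simp
  moreover have "Ck_on n S (\<lambda>x. D g x v)" for v
  proof (rule Suc.IH)
    show "D f x v = D g x v" if "x \<in> S" for x
      using D_cong[OF assms(1) that] Suc.prems(1) by blast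
    show "Ck_on n S (\<lambda>x. D f x v)" using Suc.prems(2) by simp
  qed
  ultimately show ?case by simp
qed

lemma smooth_on_cong:
  assumes "open S" "\<And>x. x \<in> S \<Longrightarrow> f x = g x" "smooth_on S f"
  shows "smooth_on S g"
  using Ck_on_cong[of S f g] assms unfolding smooth_on_def by blast

lemma Ck_on_const: "Ck_on n S (\<lambda>x. c)"
  by (induction n arbitrary: c) auto

lemma Ck_on_add:
  assumes "open S"
  shows "Ck_on n S f \<Longrightarrow> Ck_on n S g \<Longrightarrow> Ck_on n S (\<lambda>x. f x + g x)"
proof (induction n arbitrary: f g)
  case 0
  then show ?case by (auto intro: continuous_on_add)
next
  case (Suc n)
  have "D (\<lambda>x. f x + g x) x v = D f x v + D g x v" if "x \<in> S" for x v
  proof -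
    have "f differentiable (at x)" "g differentiable (at x)" using Suc.prems that by simp_all
    then show ?thesis unfolding frechet_derivative_works by (intro D_eqI has_derivative_add)
  qed
  then have "Ck_on n S (\<lambda>x. D (\<lambda>x. f x + g x) x v)" for v
    using Ck_on_cong[OF assms _ Suc.IH[of "\<lambda>x. D f x v" "\<lambda>x. D g x v"]] Suc.prems by simp
  then show ?case using Suc.prems by simp
qed

lemma Ck_on_bilinear:
  assumes "open S" "bounded_bilinear pr"
  shows "Ck_on n S f \<Longrightarrow> Ck_on n S g \<Longrightarrow> Ck_on n S (\<lambda>x. pr (f x) (g x))"
proof (induction n arbitrary: f g)
  case 0
  then show ?case
    by (auto intro: bounded_bilinear.continuous_on[OF assms(2)])
next
  case (Suc n)
  have deriv: "((\<lambda>x. pr (f x) (g x)) has_derivative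
      (\<lambda>v. pr (f x) (D g x v) + pr (D f x v) (g x))) (at x)" if "x \<in> S" for x
  proof -
    have "f differentiable (at x)" "g differentiable (at x)" using Suc.prems that by simp_all
    then show ?thesis
      unfolding frechet_derivative_works by (intro bounded_bilinear.FDERIV[OF assms(2)])
  qed
  have fg: "Ck_on n S f" "Ck_on n S g" using Suc.prems Ck_on_Suc_imp by blast+
  have "Ck_on n S (\<lambda>x. D (\<lambda>x. pr (f x) (g x)) x v)" for v
  proof (rule Ck_on_cong[OF assms(1)])
    show "pr (f x) (D g x v) + pr (D f x v) (g x) = D (\<lambda>x. pr (f x) (g x)) x v" if "x \<in> S" for x
      by (rule D_eqI[OF deriv[OF that], symmetric])
    show "Ck_on n S (\<lambda>x. pr (f x) (D g x v) + pr (D f x v) (g x))"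
      using Suc.prems fg
        Ck_on_add[OF assms(1) Suc.IH[of f "\<lambda>x. D g x v"] Suc.IH[of "\<lambda>x. D f x v" g]] by simp
  qed
  moreover have "(\<lambda>x. pr (f x) (g x)) differentiable (at x)" if "x \<in> S" for x
    using deriv[OF that] by (rule differentiableI)
  ultimately show ?case by simp
qed

lemma smooth_on_const: "smooth_on S (\<lambda>x. c)"
  by (simp add: smooth_on_def Ck_on_const)

lemma smooth_on_add: "open S \<Longrightarrow> smooth_on S f \<Longrightarrow> smooth_on S g \<Longrightarrow> smooth_on S (\<lambda>x. f x + g x)"
  unfolding smooth_on_def by (blast intro: Ck_on_add)

lemma smooth_on_bilinear:
  "open S \<Longrightarrow> bounded_bilinear pr \<Longrightarrow> smooth_on S f \<Longrightarrow> smooth_on S g \<Longrightarrow> smooth_on S (\<lambda>x. pr (f x) (g x))"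
  unfolding smooth_on_def using Ck_on_bilinear[of S pr _ f g] by simp

lemma smooth_on_linear:
  assumes "open S" "bounded_linear h" "smooth_on S f"
  shows "smooth_on S (\<lambda>x. h (f x))"
proof -
  interpret h: bounded_linear h by fact
  have "bounded_bilinear (\<lambda>r::real. \<lambda>v. r *\<^sub>R h v)"
    by (rule bounded_bilinear.comp[OF bounded_bilinear_scaleR bounded_linear_ident assms(2)])
  from smooth_on_bilinear[OF assms(1) this smooth_on_const[of S 1] assms(3)] show ?thesis by simp
qed

lemma smooth_on_mult:
  fixes f g :: "_ \<Rightarrow> real"
  shows "open S \<Longrightarrow> smooth_on S f \<Longrightarrow> smooth_on S g \<Longrightarrow> smooth_on S (\<lambda>x. f x * g x)"
  by (rule smooth_on_bilinear[OF _ bounded_bilinear_mult])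

lemma smooth_on_diff: "open S \<Longrightarrow> smooth_on S f \<Longrightarrow> smooth_on S g \<Longrightarrow> smooth_on S (\<lambda>x. f x - g x)"
  using smooth_on_add[of S f "\<lambda>x. - g x"] smooth_on_linear[of S uminus g]
  by (simp add: bounded_linear_minus[OF bounded_linear_ident])

lemma smooth_on_sum:
  assumes "open S" "\<And>i. i \<in> I \<Longrightarrow> smooth_on S (f i)"
  shows "smooth_on S (\<lambda>x. \<Sum>i\<in>I. f i x)"
  using assms(2)
proof (induction I rule: infinite_finite_induct)
  case (insert i I)
  then show ?case using smooth_on_add[OF assms(1), of "f i" "\<lambda>x. \<Sum>i\<in>I. f i x"] by simp
qed (simp_all add: smooth_on_const)

lemma smooth_on_prod:
  fixes f :: "'i \<Rightarrow> 'a::real_normed_vector \<Rightarrow> real"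
  assumes "open S" "\<And>i. i \<in> I \<Longrightarrow> smooth_on S (f i)"
  shows "smooth_on S (\<lambda>x. \<Prod>i\<in>I. f i x)"
  using assms(2)
proof (induction I rule: infinite_finite_induct)
  case (insert i I)
  then show ?case using smooth_on_mult[OF assms(1), of "f i" "\<lambda>x. \<Prod>i\<in>I. f i x"] by simp
qed (simp_all add: smooth_on_const)

lemma smooth_on_nth: "open S \<Longrightarrow> smooth_on S f \<Longrightarrow> smooth_on S (\<lambda>x. f x $ i)"
  by (rule smooth_on_linear[OF _ bounded_linear_vec_nth])

lemma smooth_on_vec:
  fixes f :: "_ \<Rightarrow> 'n::finite \<Rightarrow> 'b::euclidean_space"
  assumes "open S" "\<And>i. smooth_on S (\<lambda>x. f x i)"
  shows "smooth_on S (\<lambda>x. \<chi> i. f x i)"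
proof -
  have lin: "bounded_linear (\<lambda>v::'b. axis i v)" for i :: 'n
    unfolding linear_conv_bounded_linear[symmetric] by (rule linearI) (auto simp: axis_def vec_eq_iff)
  have "(\<chi> i. f x i) = (\<Sum>i\<in>UNIV. axis i (f x i))" for x
    by (simp add: vec_eq_iff axis_def)
  then show ?thesis
    using smooth_on_sum[OF assms(1) smooth_on_linear[OF assms(1) lin assms(2)]] by simp
qed

lemma smooth_on_inverse:
  fixes f :: "'a::real_normed_vector \<Rightarrow> real"
  assumes "open S" "smooth_on S f" "\<And>x. x \<in> S \<Longrightarrow> f x \<noteq> 0"
  shows "smooth_on S (\<lambda>x. inverse (f x))"
proof -
  have "Ck_on n S (\<lambda>x. inverse (f x))" for n
  proof (induction n)
    case 0
    then show ?case
      using smooth_on_continuous[OF assms(2)] assms(3) by (auto intro: continuous_on_inverse)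
  next
    case (Suc n)
    have deriv: "((\<lambda>x. inverse (f x)) has_derivative
        (\<lambda>v. (- 1) * (inverse (f x) * D f x v * inverse (f x)))) (at x)" if "x \<in> S" for x
      using Deriv.has_derivative_inverse[OF assms(3)[OF that] smooth_on_has_derivative[OF assms(2) that]]
      by simp
    have "Ck_on n S (\<lambda>x. (- 1) * (inverse (f x) * D f x v * inverse (f x)))" for v
      using smooth_on_D[OF assms(2), of v] unfolding smooth_on_def
      by (intro Ck_on_bilinear[OF assms(1) bounded_bilinear_mult] Suc Ck_on_const) auto
    then have "Ck_on n S (\<lambda>x. D (\<lambda>x. inverse (f x)) x v)" for v
      by (rule Ck_on_cong[OF assms(1), rotated]) (rule D_eqI[OF deriv, symmetric])
    moreover have "(\<lambda>x. inverse (f x)) differentiable (at x)" if "x \<in> S" for x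
      using deriv[OF that] by (rule differentiableI)
    ultimately show ?case by simp
  qed
  then show ?thesis by (simp add: smooth_on_def)
qed

lemma smooth_on_det:
  fixes A :: "'a::real_normed_vector \<Rightarrow> real ^ 'n ^ 'n::finite"
  assumes "open S" "smooth_on S A"
  shows "smooth_on S (\<lambda>x. det (A x))"
  unfolding det_def using assms
  by (intro smooth_on_sum smooth_on_mult smooth_on_prod smooth_on_const smooth_on_nth) auto

text \<open>By Cramer's rule the solution is a quotient of determinants. This makes the covariant derivative
  smooth without treating the inverse matrix in the Christoffel symbols as a function of the
  point: the lowered covariant derivative is visibly smooth, and the metric is invertible.\<close>

lemma smooth_on_linear_solution:
  fixes G :: "'a::real_normed_vector \<Rightarrow> real ^ 'n ^ 'n::finite"
  assumes S: "open S" and G: "smooth_on S G" and b: "smooth_on S b"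
    and inv: "\<And>x. x \<in> S \<Longrightarrow> invertible (G x)"
    and sol: "\<And>x. x \<in> S \<Longrightarrow> G x *v h x = b x"
  shows "smooth_on S h"
proof (rule smooth_on_cong[OF S])
  let ?N = "\<lambda>x k. \<chi> i j. if j = k then b x $ i else G x $ i $ j"
  show "(\<chi> k. det (?N x k) * inverse (det (G x))) = h x" if "x \<in> S" for x
    using inv[OF that] sol[OF that] cramer[of "G x" "h x" "b x"]
    by (simp add: invertible_det_nz divide_inverse)
  have "smooth_on S (\<lambda>x. ?N x k)" for k
  proof (intro smooth_on_vec S)
    show "smooth_on S (\<lambda>x. if j = k then b x $ i else G x $ i $ j)" for i j
      using S G b by (cases "j = k") (simp_all add: smooth_on_nth)
  qed
  then have "smooth_on S (\<lambda>x. det (?N x k) * inverse (det (G x)))" for k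
    using inv by (intro smooth_on_mult smooth_on_inverse smooth_on_det S G) (auto simp: invertible_det_nz)
  then show "smooth_on S (\<lambda>x. \<chi> k. det (?N x k) * inverse (det (G x)))"
    by (rule smooth_on_vec[OF S])
qed

text \<open>The mean value theorem, once in direction \<open>v\<close> and once in direction \<open>w\<close>. The second difference
  is symmetric in \<open>v\<close> and \<open>w\<close>, which forces the mixed derivatives to agree in the limit.\<close>

lemma second_difference:
  fixes f :: "'a::real_normed_vector \<Rightarrow> real"
  assumes h: "h > 0"
    and f: "\<And>s t. 0 \<le> s \<Longrightarrow> s \<le> h \<Longrightarrow> 0 \<le> t \<Longrightarrow> t \<le> h \<Longrightarrow> f differentiable (at (x + s *\<^sub>R v + t *\<^sub>R w))"
    and f': "\<And>s t. 0 \<le> s \<Longrightarrow> s \<le> h \<Longrightarrow> 0 \<le> t \<Longrightarrow> t \<le> h \<Longrightarrow>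
        (\<lambda>y. D f y v) differentiable (at (x + s *\<^sub>R v + t *\<^sub>R w))"
  obtains s t where "0 < s" "s < h" "0 < t" "t < h"
    "f (x + h *\<^sub>R v + h *\<^sub>R w) - f (x + h *\<^sub>R v) - f (x + h *\<^sub>R w) + f x =
     h * h * D (\<lambda>y. D f y v) (x + s *\<^sub>R v + t *\<^sub>R w) w"
proof -
  define g where "g s = f (x + s *\<^sub>R v + h *\<^sub>R w) - f (x + s *\<^sub>R v)" for s
  have along: "((\<lambda>s. f (x + s *\<^sub>R v + t *\<^sub>R w)) has_derivative (\<lambda>r. r * D f (x + s *\<^sub>R v + t *\<^sub>R w) v)) (at s)"
    if "0 \<le> s" "s \<le> h" "0 \<le> t" "t \<le> h" for s t
  proof -
    have d: "(f has_derivative D f (x + s *\<^sub>R v + t *\<^sub>R w)) (at (x + s *\<^sub>R v + t *\<^sub>R w))"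
      using f[OF that] frechet_derivative_works by blast
    have i: "((\<lambda>s. x + s *\<^sub>R v + t *\<^sub>R w) has_derivative (\<lambda>r. r *\<^sub>R v)) (at s)"
      by (auto intro!: derivative_eq_intros)
    show ?thesis
      using has_derivative_compose[OF i d] linear_cmul[OF has_derivative_linear[OF d]] by simp
  qed
  have g': "(g has_real_derivative D f (x + s *\<^sub>R v + h *\<^sub>R w) v - D f (x + s *\<^sub>R v) v) (at s)"
    if "0 \<le> s" "s \<le> h" for s
  proof -
    have "(\<lambda>s. f (x + s *\<^sub>R v + h *\<^sub>R w) - f (x + s *\<^sub>R v + 0 *\<^sub>R w)) = g"
      by (auto simp: g_def)
    moreover have "(\<lambda>r. r * D f (x + s *\<^sub>R v + h *\<^sub>R w) v - r * D f (x + s *\<^sub>R v + 0 *\<^sub>R w) v) =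
        (*) (D f (x + s *\<^sub>R v + h *\<^sub>R w) v - D f (x + s *\<^sub>R v) v)"
      by (auto simp: algebra_simps)
    ultimately show ?thesis
      using has_derivative_diff[OF along[OF that, of h] along[OF that, of 0]] h
      by (simp add: has_field_derivative_def)
  qed
  obtain s where s: "0 < s" "s < h"
    "g h - g 0 = (h - 0) * (D f (x + s *\<^sub>R v + h *\<^sub>R w) v - D f (x + s *\<^sub>R v) v)"
    using MVT2[OF h, of g "\<lambda>s. D f (x + s *\<^sub>R v + h *\<^sub>R w) v - D f (x + s *\<^sub>R v) v"] g' by auto
  have k': "((\<lambda>t. D f (x + s *\<^sub>R v + t *\<^sub>R w) v) has_real_derivative
      D (\<lambda>y. D f y v) (x + s *\<^sub>R v + t *\<^sub>R w) w) (at t)" if "0 \<le> t" "t \<le> h" for t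
  proof -
    have d: "((\<lambda>y. D f y v) has_derivative D (\<lambda>y. D f y v) (x + s *\<^sub>R v + t *\<^sub>R w)) (at (x + s *\<^sub>R v + t *\<^sub>R w))"
      using f'[of s t] that s frechet_derivative_works less_imp_le by blast
    have i: "((\<lambda>t. x + s *\<^sub>R v + t *\<^sub>R w) has_derivative (\<lambda>r. r *\<^sub>R w)) (at t)"
      by (auto intro!: derivative_eq_intros)
    show ?thesis
      using has_derivative_compose[OF i d] linear_cmul[OF has_derivative_linear[OF d]]
      by (simp add: has_field_derivative_def mult_commute_abs)
  qed
  obtain t where t: "0 < t" "t < h"
    "D f (x + s *\<^sub>R v + h *\<^sub>R w) v - D f (x + s *\<^sub>R v + 0 *\<^sub>R w) v =
      (h - 0) * D (\<lambda>y. D f y v) (x + s *\<^sub>R v + t *\<^sub>R w) w"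
    using MVT2[OF h k'] by auto
  show thesis
    using that[OF s(1,2) t(1,2)] s(3) t(3) by (simp add: g_def algebra_simps)
qed

lemma symmetric_second_derivative_real:
  fixes f :: "'a::real_normed_vector \<Rightarrow> real"
  assumes S: "open S" and x: "x \<in> S" and f: "smooth_on S f"
  shows "D (\<lambda>y. D f y v) x w = D (\<lambda>y. D f y w) x v"
proof (rule ccontr)
  let ?P = "\<lambda>y. D (\<lambda>y. D f y v) y w" and ?Q = "\<lambda>y. D (\<lambda>y. D f y w) y v"
  assume neq: "?P x \<noteq> ?Q x"
  define e where "e = \<bar>?P x - ?Q x\<bar> / 2"
  have e: "e > 0" using neq by (simp add: e_def)
  have cont: "isCont (\<lambda>y. D (\<lambda>y. D f y a) y b) x" for a b
    using smooth_on_continuous[OF smooth_on_D[OF smooth_on_D[OF f]]] S x continuous_on_eq_continuous_at by blast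
  obtain r where r: "r > 0" "ball x r \<subseteq> S" using S x open_contains_ball by blast
  obtain d1 where d1: "d1 > 0" "\<And>y. dist y x < d1 \<Longrightarrow> \<bar>?P y - ?P x\<bar> < e"
    using cont[of v w] e unfolding continuous_at_eps_delta dist_real_def by meson
  obtain d2 where d2: "d2 > 0" "\<And>y. dist y x < d2 \<Longrightarrow> \<bar>?Q y - ?Q x\<bar> < e"
    using cont[of w v] e unfolding continuous_at_eps_delta dist_real_def by meson
  define d where "d = min r (min d1 d2)"
  \<comment> \<open>this step keeps the parallelogram spanned by \<open>h v\<close> and \<open>h w\<close> at \<open>x\<close> within distance \<open>d\<close>\<close>
  define h where "h = d / (2 * (norm v + norm w + 1))"
  have d: "d > 0" using r d1 d2 by (simp add: d_def)
  have nn: "0 < norm v + norm w + 1" using norm_ge_zero[of v] norm_ge_zero[of w] by linarith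
  have h: "h > 0" using d nn by (simp add: h_def)
  have small: "dist (x + s *\<^sub>R v + t *\<^sub>R w) x < d" if "0 \<le> s" "s \<le> h" "0 \<le> t" "t \<le> h" for s t
  proof -
    have "dist (x + s *\<^sub>R v + t *\<^sub>R w) x = norm (s *\<^sub>R v + t *\<^sub>R w)" by (simp add: dist_norm)
    also have "\<dots> \<le> h * norm v + h * norm w"
      using that norm_triangle_ineq[of "s *\<^sub>R v" "t *\<^sub>R w"]
        mult_right_mono[of s h "norm v"] mult_right_mono[of t h "norm w"] by simp
    also have "\<dots> \<le> h * (norm v + norm w + 1)" using h by (simp add: algebra_simps)
    also have "\<dots> = d / 2" using nn by (simp add: h_def field_simps)
    finally show ?thesis using d by simp
  qed
  have inS: "x + s *\<^sub>R v + t *\<^sub>R w \<in> S" if "0 \<le> s" "s \<le> h" "0 \<le> t" "t \<le> h" for s t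
    using small[OF that] r by (auto simp: d_def dist_commute)
  have inS': "x + s *\<^sub>R w + t *\<^sub>R v \<in> S" if "0 \<le> s" "s \<le> h" "0 \<le> t" "t \<le> h" for s t
    using inS[of t s] that by (simp add: algebra_simps)
  let ?\<Delta> = "f (x + h *\<^sub>R v + h *\<^sub>R w) - f (x + h *\<^sub>R v) - f (x + h *\<^sub>R w) + f x"
  obtain s t where st: "0 < s" "s < h" "0 < t" "t < h" "?\<Delta> = h * h * ?P (x + s *\<^sub>R v + t *\<^sub>R w)"
    using second_difference[OF h, of f x v w] inS smooth_on_differentiable[OF f]
      smooth_on_differentiable[OF smooth_on_D[OF f]] by blast
  obtain s' t' where st': "0 < s'" "s' < h" "0 < t'" "t' < h"
    "f (x + h *\<^sub>R w + h *\<^sub>R v) - f (x + h *\<^sub>R w) - f (x + h *\<^sub>R v) + f x = h * h * ?Q (x + s' *\<^sub>R w + t' *\<^sub>R v)"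
    using second_difference[OF h, of f x w v] inS' smooth_on_differentiable[OF f]
      smooth_on_differentiable[OF smooth_on_D[OF f]] by blast
  have "?P (x + s *\<^sub>R v + t *\<^sub>R w) = ?Q (x + t' *\<^sub>R v + s' *\<^sub>R w)"
    using st(5) st'(5) h by (simp add: algebra_simps)
  moreover have "\<bar>?P (x + s *\<^sub>R v + t *\<^sub>R w) - ?P x\<bar> < e"
    using small[of s t] st by (intro d1(2)) (auto simp: d_def)
  moreover have "\<bar>?Q (x + t' *\<^sub>R v + s' *\<^sub>R w) - ?Q x\<bar> < e"
    using small[of t' s'] st' by (intro d2(2)) (auto simp: d_def)
  ultimately show False unfolding e_def by (smt (verit) field_sum_of_halves)
qed

lemma D_linear:
  assumes "bounded_linear h" "f differentiable (at x)"
  shows "D (\<lambda>y. h (f y)) x v = h (D f x v)"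
  using bounded_linear.has_derivative[OF assms(1)] assms(2) D_eqI frechet_derivative_works by fastforce

text \<open>Needed twice: for the closedness of the vorticity form, and for the tensoriality of the covariant
  derivative, where the Hessian of the transition map has to cancel.\<close>

lemma symmetric_second_derivative:
  fixes f :: "'a::real_normed_vector \<Rightarrow> 'b::real_inner"
  assumes S: "open S" and x: "x \<in> S" and f: "smooth_on S f"
  shows "D (\<lambda>y. D f y v) x w = D (\<lambda>y. D f y w) x v"
proof -
  have "D (\<lambda>y. D f y v) x w \<bullet> b = D (\<lambda>y. D f y w) x v \<bullet> b" for b
  proof -
    have bl: "bounded_linear (\<lambda>z::'b. z \<bullet> b)" by (rule bounded_linear_inner_left)
    have eq: "D (\<lambda>y. D f y u \<bullet> b) x u' = D (\<lambda>y. D (\<lambda>z. f z \<bullet> b) y u) x u'" for u u'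
      by (rule D_cong[OF S x], subst D_linear[OF bl smooth_on_differentiable[OF f]]) auto
    show ?thesis
      using D_linear[OF bl smooth_on_differentiable[OF smooth_on_D[OF f] x], of _ ] eq
        symmetric_second_derivative_real[OF S x smooth_on_linear[OF S bl f]] by metis
  qed
  then show ?thesis by (metis vector_eq_rdot)
qed

section \<open>The covariant derivative of a vector field in a chart\<close>

lemma bounded_bilinear_matrix_vector:
  "bounded_bilinear ((*v) :: real ^ 'n ^ 'm \<Rightarrow> real ^ 'n \<Rightarrow> real ^ 'm::finite)"
  unfolding bilinear_conv_bounded_bilinear[symmetric] bilinear_def
  by (auto intro!: linearI simp: matrix_vector_right_distrib matrix_vector_mult_add_rdistrib
      matrix_vector_mult_scaleR scaleR_matrix_vector_assoc)

lemma bounded_bilinear_matrix_matrix: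
  "bounded_bilinear ((**) :: real ^ 'n ^ 'm \<Rightarrow> real ^ 'p ^ 'n \<Rightarrow> real ^ 'p::finite ^ 'm::finite)"
  unfolding bilinear_conv_bounded_bilinear[symmetric] bilinear_def
  by (auto intro!: linearI simp: matrix_matrix_mult_def vec_eq_iff sum.distrib algebra_simps sum_distrib_left)

lemma bounded_linear_transpose: "bounded_linear (transpose :: real ^ 'n ^ 'm \<Rightarrow> real ^ 'm::finite ^ 'n::finite)"
  unfolding linear_conv_bounded_linear[symmetric] by (rule linearI) (auto simp: transpose_def vec_eq_iff)

lemma bounded_linear_trace: "bounded_linear (trace :: real ^ 'n ^ 'n::finite \<Rightarrow> real)"
  unfolding linear_conv_bounded_linear[symmetric]
  by (rule linearI) (auto simp: trace_def sum.distrib sum_distrib_left)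

lemma D_bilinear:
  assumes "bounded_bilinear pr" "f differentiable (at x)" "g differentiable (at x)"
  shows "D (\<lambda>y. pr (f y) (g y)) x v = pr (f x) (D g x v) + pr (D f x v) (g x)"
  using assms(2,3) unfolding frechet_derivative_works
  by (intro D_eqI bounded_bilinear.FDERIV[OF assms(1)])

lemma D_diff:
  assumes "f differentiable (at x)" "g differentiable (at x)"
  shows "D (\<lambda>y. f y - g y) x v = D f x v - D g x v"
  using assms unfolding frechet_derivative_works by (intro D_eqI has_derivative_diff)

lemma vec_eq_sum_axis: "(v :: real ^ 'n::finite) = (\<Sum>i\<in>UNIV. v $ i *\<^sub>R axis i 1)"
  by (simp add: vec_eq_iff axis_def if_distrib cong: if_cong)

lemma linear_eq_sum_axis:
  fixes f :: "real ^ 'n::finite \<Rightarrow> 'b::real_vector"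
  assumes "linear f"
  shows "f v = (\<Sum>i\<in>UNIV. v $ i *\<^sub>R f (axis i 1))"
  by (subst vec_eq_sum_axis[of v]) (simp only: linear_sum[OF assms] linear_cmul[OF assms])

lemma linear_eq_axis:
  fixes f g :: "real ^ 'n::finite \<Rightarrow> 'b::real_vector"
  assumes "linear f" "linear g" "\<And>i. f (axis i 1) = g (axis i 1)"
  shows "f v = g v"
  unfolding linear_eq_sum_axis[OF assms(1), of v] linear_eq_sum_axis[OF assms(2), of v] assms(3) ..

lemma mip_linear_left: "linear (\<lambda>v. mip G v w)"
  by (rule linearI) (simp_all add: mip_def inner_add_left)

lemma mip_linear_right: "linear (mip G v)"
  by (rule linearI) (simp_all add: mip_def inner_add_right matrix_vector_right_distrib matrix_vector_mult_scaleR)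

lemma mip_linear_matrix: "linear (\<lambda>G. mip G v w)"
  by (rule linearI)
    (simp_all add: mip_def inner_add_right matrix_vector_mult_add_rdistrib flip: scaleR_matrix_vector_assoc)

lemmas mip_simps =
  linear_add[OF mip_linear_left] linear_add[OF mip_linear_right] linear_add[OF mip_linear_matrix]
  linear_diff[OF mip_linear_left] linear_diff[OF mip_linear_right] linear_diff[OF mip_linear_matrix]
  linear_cmul[OF mip_linear_left] linear_cmul[OF mip_linear_right] linear_cmul[OF mip_linear_matrix]
  linear_neg[OF mip_linear_left] linear_neg[OF mip_linear_right] linear_neg[OF mip_linear_matrix]
  linear_0[OF mip_linear_left] linear_0[OF mip_linear_right] linear_0[OF mip_linear_matrix]

lemma mip_axis: "mip A (axis i 1) (axis j 1) = A $ i $ j"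
  by (simp add: mip_def inner_axis' matrix_vector_mul_component inner_axis)

lemma mip_axis_left: "mip A (axis i 1) v = (A *v v) $ i"
  by (simp add: mip_def inner_axis')

lemma mip_transpose: "mip (transpose A) v w = mip A w v"
  by (simp add: mip_def dot_lmul_matrix[symmetric] transpose_matrix_vector inner_commute)

lemma mip_commute: "transpose A = A \<Longrightarrow> mip A v w = mip A w v"
  by (metis mip_transpose)

lemma matrix_eqI_mip: "(\<And>v w. mip A v w = mip B v w) \<Longrightarrow> A = B"
  by (simp add: vec_eq_iff mip_axis[symmetric])

lemma smooth_on_mip:
  fixes A :: "'a::real_normed_vector \<Rightarrow> real ^ 'n ^ 'n::finite"
  assumes "open S" "smooth_on S A" "smooth_on S f" "smooth_on S g"
  shows "smooth_on S (\<lambda>x. mip (A x) (f x) (g x))"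
  unfolding mip_def
  by (intro smooth_on_bilinear[OF assms(1) bounded_bilinear_inner]
      smooth_on_bilinear[OF assms(1) bounded_bilinear_matrix_vector] assms)

lemma D_mip:
  fixes A :: "'a::real_normed_vector \<Rightarrow> real ^ 'n ^ 'n::finite"
  assumes "A differentiable (at x)" "f differentiable (at x)" "g differentiable (at x)"
  shows "D (\<lambda>y. mip (A y) (f y) (g y)) x u =
    mip (D A x u) (f x) (g x) + mip (A x) (D f x u) (g x) + mip (A x) (f x) (D g x u)"
proof -
  have "(\<lambda>y. A y *v g y) differentiable (at x)"
    using assms(1,3) bounded_bilinear.FDERIV[OF bounded_bilinear_matrix_vector]
    unfolding differentiable_def by blast
  then show ?thesis
    unfolding mip_def
    using assms by (simp add: D_bilinear[OF bounded_bilinear_inner] D_bilinear[OF bounded_bilinear_matrix_vector]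
        inner_add_right)
qed

text \<open>The difference between the covariant and the coordinate derivative, as a bilinear map; it allows
  the rest of the development to avoid indices.\<close>

definition christoffel_vector ::
    "(real ^ 'n \<Rightarrow> real ^ 'n ^ 'n) \<Rightarrow> real ^ 'n \<Rightarrow> real ^ 'n \<Rightarrow> real ^ 'n \<Rightarrow> real ^ 'n::finite" where
  "christoffel_vector G x u v = (\<chi> l. \<Sum>i\<in>UNIV. \<Sum>j\<in>UNIV. christoffel G x i j l * u $ i * v $ j)"

lemma nabla_eq: "nabla G X Y x = D Y x (X x) + christoffel_vector G x (X x) (Y x)"
  by (simp add: nabla_def covd_def christoffel_vector_def)

lemma christoffel_vector_linear_left: "linear (\<lambda>u. christoffel_vector G x u v)"
  by (rule linearI)
    (auto simp: christoffel_vector_def vec_eq_iff algebra_simps sum.distrib sum_distrib_left)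

lemma christoffel_vector_linear_right: "linear (christoffel_vector G x u)"
  by (rule linearI)
    (auto simp: christoffel_vector_def vec_eq_iff algebra_simps sum.distrib sum_distrib_left)

lemma christoffel_vector_axis:
  "christoffel_vector G x (axis i 1) (axis j 1) = (\<chi> l. christoffel G x i j l)"
proof -
  have "christoffel G x a b l * axis i 1 $ a * axis j 1 $ b =
      (if b = j then if a = i then christoffel G x a b l else 0 else 0)" for a b l
    by (simp add: axis_def)
  then show ?thesis by (simp add: christoffel_vector_def)
qed

text \<open>The endomorphism \<open>B\<close> of the introduction. Since \<^const>\<open>nabla\<close> is tensorial in its direction, constant
  directions suffice.\<close>

definition nabla_matrix :: "(real ^ 'n \<Rightarrow> real ^ 'n ^ 'n) \<Rightarrow> (real ^ 'n \<Rightarrow> real ^ 'n) \<Rightarrow> real ^ 'n \<Rightarrow> real ^ 'n ^ 'n::finite" where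
  "nabla_matrix G K x = matrix (\<lambda>u. nabla G (\<lambda>_. u) K x)"

text \<open>The matrix of the 2-form \<open>\<Omega>\<close>: the antisymmetric part, up to a factor of two, of \<open>B\<close> with lowered
  index. Its value on \<open>v\<close>, \<open>u\<close> in this order is \<open>\<Omega>(u, v)\<close>.\<close>

definition vorticity :: "(real ^ 'n \<Rightarrow> real ^ 'n ^ 'n) \<Rightarrow> (real ^ 'n \<Rightarrow> real ^ 'n) \<Rightarrow> real ^ 'n \<Rightarrow> real ^ 'n ^ 'n::finite" where
  "vorticity G K x = G x ** nabla_matrix G K x - transpose (G x ** nabla_matrix G K x)"

definition expansion :: "(real ^ 'n \<Rightarrow> real ^ 'n ^ 'n) \<Rightarrow> (real ^ 'n \<Rightarrow> real ^ 'n) \<Rightarrow> real ^ 'n \<Rightarrow> real" where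
  "expansion G K x = trace (nabla_matrix G K x :: real ^ 'n ^ 'n::finite)"

locale riemannian_field =
  fixes U :: "(real ^ 'n::finite) set" and G :: "real ^ 'n \<Rightarrow> real ^ 'n ^ 'n" and K :: "real ^ 'n \<Rightarrow> real ^ 'n"
  assumes open_U: "open U" and smooth_G: "smooth_on U G" and smooth_K: "smooth_on U K"
    and sym_G: "\<And>x. x \<in> U \<Longrightarrow> transpose (G x) = G x"
    and pos_G: "\<And>x v. x \<in> U \<Longrightarrow> v \<noteq> 0 \<Longrightarrow> mip (G x) v v > 0"
begin

abbreviation B where "B \<equiv> nabla_matrix G K"

lemmas diff_G = smooth_on_differentiable[OF smooth_G] and diff_K = smooth_on_differentiable[OF smooth_K]

lemma mip_commute_G: "x \<in> U \<Longrightarrow> mip (G x) v w = mip (G x) w v"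
  by (rule mip_commute[OF sym_G])

lemma sym_DG: "x \<in> U \<Longrightarrow> transpose (D G x u) = D G x u"
  using D_linear[OF bounded_linear_transpose diff_G, of x u]
    D_cong[where x = x and v = u, OF open_U _ sym_G] by simp

lemma mip_commute_DG: "x \<in> U \<Longrightarrow> mip (D G x u) v w = mip (D G x u) w v"
  by (rule mip_commute[OF sym_DG])

lemma invertible_G:
  assumes "x \<in> U"
  shows "invertible (G x)"
proof -
  have "G x *v v = 0 \<longrightarrow> v = 0" for v
    using pos_G[OF assms, of v] by (cases "v = 0") (auto simp: mip_def)
  then show ?thesis by (simp add: invertible_left_inverse matrix_left_invertible_ker)
qed

lemma mip_G_eqD:
  assumes "x \<in> U" "\<And>w. mip (G x) u w = mip (G x) v w"
  shows "u = v"
  using pos_G[OF assms(1), of "u - v"] assms(2)[of "u - v"] by (force simp: mip_simps)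

text \<open>Both sides are linear in \<open>u\<close>, \<open>v\<close> and \<open>w\<close>, so it suffices to compare them on coordinate vectors, where
  this is the definition of the Christoffel symbols with the index lowered. The vectors are
  generalised from coordinate vectors one at a time.\<close>

lemma koszul:
  assumes x: "x \<in> U"
  shows "2 * mip (G x) (christoffel_vector G x u v) w =
    mip (D G x u) v w + mip (D G x v) u w - mip (D G x w) u v"
proof -
  have pd: "pd i (\<lambda>z. G z $ j $ m) x = D G x (axis i 1) $ j $ m" for i j m
    unfolding pd_def
    using D_linear[OF bounded_linear_compose[OF bounded_linear_vec_nth[of m] bounded_linear_vec_nth[of j]] diff_G[OF x]] .
  note lin = linear_frechet_derivative[OF diff_G[OF x]]
  note simps = mip_simps linear_add[OF lin] linear_cmul[OF lin]
    linear_add[OF christoffel_vector_linear_left] linear_cmul[OF christoffel_vector_linear_left]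
    linear_add[OF christoffel_vector_linear_right] linear_cmul[OF christoffel_vector_linear_right]
  have 1: "2 * mip (G x) (christoffel_vector G x (axis i 1) (axis j 1)) (axis m 1) =
    mip (D G x (axis i 1)) (axis j 1) (axis m 1) + mip (D G x (axis j 1)) (axis i 1) (axis m 1)
    - mip (D G x (axis m 1)) (axis i 1) (axis j 1)" for i j m
    unfolding mip_commute_G[OF x, of _ "axis m 1"]
    using christoffel_lower[where G = G, OF invertible_G[OF x], of m i j]
    unfolding mip_axis by (simp add: christoffel_vector_axis mip_axis_left matrix_vector_mult_def pd)
  have 2: "2 * mip (G x) (christoffel_vector G x (axis i 1) (axis j 1)) w =
    mip (D G x (axis i 1)) (axis j 1) w + mip (D G x (axis j 1)) (axis i 1) w
    - mip (D G x w) (axis i 1) (axis j 1)" for i j w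
    by (rule linear_eq_axis[where v = w
        and f = "\<lambda>w. 2 * mip (G x) (christoffel_vector G x (axis i 1) (axis j 1)) w"
        and g = "\<lambda>w. mip (D G x (axis i 1)) (axis j 1) w + mip (D G x (axis j 1)) (axis i 1) w - mip (D G x w) (axis i 1) (axis j 1)"])
      ((rule linearI; simp add: simps algebra_simps) | rule 1)+
  have 3: "2 * mip (G x) (christoffel_vector G x (axis i 1) v) w =
    mip (D G x (axis i 1)) v w + mip (D G x v) (axis i 1) w - mip (D G x w) (axis i 1) v" for i v w
    by (rule linear_eq_axis[where v = v
        and f = "\<lambda>v. 2 * mip (G x) (christoffel_vector G x (axis i 1) v) w"
        and g = "\<lambda>v. mip (D G x (axis i 1)) v w + mip (D G x v) (axis i 1) w - mip (D G x w) (axis i 1) v"])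
      ((rule linearI; simp add: simps algebra_simps) | rule 2)+
  show ?thesis
    by (rule linear_eq_axis[where v = u
        and f = "\<lambda>u. 2 * mip (G x) (christoffel_vector G x u v) w"
        and g = "\<lambda>u. mip (D G x u) v w + mip (D G x v) u w - mip (D G x w) u v"])
      ((rule linearI; simp add: simps algebra_simps) | rule 3)+
qed

lemma christoffel_vector_commute:
  assumes x: "x \<in> U"
  shows "christoffel_vector G x u v = christoffel_vector G x v u"
proof (rule mip_G_eqD[OF x])
  show "mip (G x) (christoffel_vector G x u v) w = mip (G x) (christoffel_vector G x v u) w" for w
    using koszul[OF x, of u v w] koszul[OF x, of v u w] mip_commute_DG[OF x, of w u v] by linarith
qed

lemma B_mult:
  assumes "x \<in> U"
  shows "B x *v u = D K x u + christoffel_vector G x u (K x)"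
proof -
  have "linear (\<lambda>u. D K x u + christoffel_vector G x u (K x))"
    using linear_frechet_derivative[OF diff_K[OF assms]] christoffel_vector_linear_left
    by (intro linear_compose_add) auto
  then show ?thesis by (simp add: nabla_matrix_def nabla_eq matrix_works)
qed

lemma nabla_eq_B: "x \<in> U \<Longrightarrow> nabla G X K x = B x *v X x"
  by (simp add: nabla_eq B_mult)

lemma koszul_B:
  assumes "x \<in> U"
  shows "2 * mip (G x) (B x *v u) w =
    2 * mip (G x) (D K x u) w + mip (D G x u) (K x) w + mip (D G x (K x)) u w - mip (D G x w) u (K x)"
  using koszul[OF assms, of u "K x" w] by (simp add: B_mult[OF assms] mip_simps algebra_simps)

lemma smooth_D_along:
  assumes "smooth_on U f"
  shows "smooth_on U (\<lambda>x. D f x (K x))"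
proof (rule smooth_on_cong[OF open_U, where f = "\<lambda>x. \<Sum>i\<in>UNIV. K x $ i *\<^sub>R D f x (axis i 1)"])
  show "(\<Sum>i\<in>UNIV. K x $ i *\<^sub>R D f x (axis i 1)) = D f x (K x)" if "x \<in> U" for x
    by (rule linear_eq_sum_axis[OF linear_frechet_derivative[OF smooth_on_differentiable[OF assms that]], symmetric])
  show "smooth_on U (\<lambda>x. \<Sum>i\<in>UNIV. K x $ i *\<^sub>R D f x (axis i 1))"
    by (intro smooth_on_sum smooth_on_bilinear[OF open_U bounded_bilinear_scaleR] smooth_on_nth smooth_on_D
        open_U smooth_K assms)
qed

lemma smooth_B: "smooth_on U B"
proof -
  have col: "smooth_on U (\<lambda>x. B x *v axis j 1)" for j
  proof (rule smooth_on_linear_solution[OF open_U smooth_G _ invertible_G])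
    let ?b = "\<lambda>x w. (1/2) * (2 * mip (G x) (D K x (axis j 1)) w + mip (D G x (axis j 1)) (K x) w
      + mip (D G x (K x)) (axis j 1) w - mip (D G x w) (axis j 1) (K x))"
    show "smooth_on U (\<lambda>x. \<chi> m. ?b x (axis m 1))"
      by (intro smooth_on_vec smooth_on_mult smooth_on_add smooth_on_diff smooth_on_mip smooth_on_const open_U
          smooth_D_along smooth_on_D smooth_G smooth_K)
    show "G x *v (B x *v axis j 1) = (\<chi> m. ?b x (axis m 1))" if "x \<in> U" for x
    proof -
      have "(G x *v (B x *v axis j 1)) $ m = ?b x (axis m 1)" for m
        using koszul_B[OF that, of "axis j 1" "axis m 1"] mip_commute_G[OF that, of "axis m 1" "B x *v axis j 1"]
        unfolding mip_axis_left by simp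
      then show ?thesis by (simp add: vec_eq_iff)
    qed
  qed
  have "B x = (\<chi> i j. (B x *v axis j 1) $ i)" for x
    by (simp add: vec_eq_iff matrix_vector_mul_component inner_axis)
  then show ?thesis
    using smooth_on_vec[OF open_U smooth_on_vec[OF open_U smooth_on_nth[OF open_U col]],
        of "\<lambda>i j. j" "\<lambda>i j. i"] by simp
qed

lemma smooth_expansion: "smooth_on U (expansion G K)"
  using smooth_on_linear[OF open_U bounded_linear_trace smooth_B] by (simp add: expansion_def[abs_def])

lemma smooth_vorticity: "smooth_on U (vorticity G K)"
  unfolding vorticity_def[abs_def]
  by (intro smooth_on_diff smooth_on_linear[OF _ bounded_linear_transpose]
      smooth_on_bilinear[OF _ bounded_bilinear_matrix_matrix] open_U smooth_G smooth_B)

lemma mip_vorticity: 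
  assumes "x \<in> U"
  shows "mip (vorticity G K x) v u = mip (G x) (B x *v u) v - mip (G x) (B x *v v) u"
proof -
  have "mip (G x ** B x) v u = mip (G x) v (B x *v u)" for v u
    by (simp add: mip_def matrix_vector_mul_assoc)
  then show ?thesis
    by (simp add: vorticity_def mip_simps mip_transpose mip_commute_G[OF assms, of v] mip_commute_G[OF assms, of u])
qed

text \<open>In the antisymmetrised Koszul formula the derivatives of the metric combine to those of the
  covector field \<open>G K\<close>; hence the vorticity is the exterior derivative of \<open>\<langle>K, \<cdot>\<rangle>\<close>.\<close>

lemma mip_vorticity_exterior_derivative:
  assumes x: "x \<in> U"
  shows "mip (vorticity G K x) v u = D (\<lambda>y. G y *v K y) x u \<bullet> v - D (\<lambda>y. G y *v K y) x v \<bullet> u"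
proof -
  have lowered: "D (\<lambda>y. G y *v K y) x u \<bullet> v = mip (D G x u) (K x) v + mip (G x) (D K x u) v" for u v
    using D_bilinear[OF bounded_bilinear_matrix_vector diff_G[OF x] diff_K[OF x], of u]
      mip_commute_G[OF x, of v] mip_commute_DG[OF x, of u v]
    by (simp add: mip_def inner_add_left inner_commute[of v])
  show ?thesis
    unfolding lowered using koszul_B[OF x, of u v] koszul_B[OF x, of v u] mip_vorticity[OF x, of v u]
      mip_commute_DG[OF x, of "K x" u v] mip_commute_DG[OF x, of u v "K x"] mip_commute_DG[OF x, of v u "K x"]
    by linarith
qed

text \<open>An exterior derivative is closed, by the symmetry of second derivatives.\<close>

lemma vorticity_closed:
  assumes x: "x \<in> U"
  defines "d \<equiv> D (vorticity G K) x"
  shows "mip (d w) v u + mip (d u) w v + mip (d v) u w = 0"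
proof -
  let ?a = "\<lambda>y. G y *v K y"
  have a: "smooth_on U ?a"
    by (rule smooth_on_bilinear[OF open_U bounded_bilinear_matrix_vector smooth_G smooth_K])
  have eq: "mip (d w) v u = D (\<lambda>y. D ?a y u) x w \<bullet> v - D (\<lambda>y. D ?a y v) x w \<bullet> u" for u v w
  proof -
    have "mip (d w) v u = D (\<lambda>y. mip (vorticity G K y) v u) x w"
      using D_mip[OF smooth_on_differentiable[OF smooth_vorticity x] differentiable_const differentiable_const]
      by (simp add: d_def mip_simps)
    also have "\<dots> = D (\<lambda>y. D ?a y u \<bullet> v - D ?a y v \<bullet> u) x w"
      by (rule D_cong[OF open_U x mip_vorticity_exterior_derivative])
    also have "\<dots> = D (\<lambda>y. D ?a y u \<bullet> v) x w - D (\<lambda>y. D ?a y v \<bullet> u) x w"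
      by (intro D_diff smooth_on_differentiable[OF smooth_on_linear[OF open_U bounded_linear_inner_left] x] smooth_on_D a)
    also have "\<dots> = D (\<lambda>y. D ?a y u) x w \<bullet> v - D (\<lambda>y. D ?a y v) x w \<bullet> u"
      by (simp add: D_linear[OF bounded_linear_inner_left smooth_on_differentiable[OF smooth_on_D[OF a] x]])
    finally show ?thesis .
  qed
  show ?thesis
    unfolding eq using symmetric_second_derivative[OF open_U x a] by simp
qed

end

section \<open>Geodesic unit fields\<close>

lemma mip_congruence: "mip (transpose P ** M ** P) v w = mip M (P *v v) (P *v w)"
proof -
  have "v \<bullet> (transpose P *v z) = (P *v v) \<bullet> z" for z
    by (metis dot_lmul_matrix inner_commute transpose_matrix_vector)
  then show ?thesis
    by (simp only: mip_def matrix_vector_mul_assoc[symmetric])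
qed

text \<open>Gram-Schmidt orthonormalisation with respect to \<open>M\<close>; the columns of \<open>P\<close> are the orthonormal vectors.\<close>

lemma ex_orthonormal_matrix:
  fixes M :: "real ^ 'n ^ 'n::finite"
  assumes sym: "transpose M = M" and pos: "\<And>v. v \<noteq> 0 \<Longrightarrow> mip M v v > 0"
  obtains P :: "real ^ 'n ^ 'n" where "transpose P ** M ** P = mat 1"
proof -
  have "\<exists>f :: 'n \<Rightarrow> real ^ 'n. \<forall>i\<in>S. \<forall>j\<in>S. mip M (f i) (f j) = (if i = j then 1 else 0)"
    if "finite S" for S
    using that
  proof (induction S rule: finite_induct)
    case empty
    show ?case by simp
  next
    case (insert a S)
    then obtain f :: "'n \<Rightarrow> real ^ 'n"
      where f: "\<And>i j. i \<in> S \<Longrightarrow> j \<in> S \<Longrightarrow> mip M (f i) (f j) = (if i = j then 1 else 0)"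
      by blast
    have "dim (span (f ` S)) \<le> card (f ` S)"
      using dim_le_card[of "span (f ` S)" "f ` S"] insert.hyps(1) by (simp add: span_superset)
    also have "\<dots> \<le> card S" by (rule card_image_le[OF insert.hyps(1)])
    also have "\<dots> < CARD('n)"
      using insert.hyps by (intro psubset_card_mono) auto
    finally have "span (f ` S) \<noteq> UNIV" by (metis dim_UNIV DIM_cart DIM_real less_irrefl mult.right_neutral)
    then obtain v where v: "v \<notin> span (f ` S)" by blast
    define w where "w = v - (\<Sum>j\<in>S. mip M (f j) v *\<^sub>R f j)"
    have "w \<noteq> 0"
    proof
      assume "w = 0"
      then have "v = (\<Sum>j\<in>S. mip M (f j) v *\<^sub>R f j)" by (simp add: w_def)
      also have "\<dots> \<in> span (f ` S)" by (intro span_sum span_scale span_base) auto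
      finally show False using v by contradiction
    qed
    then have pw: "mip M w w > 0" by (rule pos)
    have orth: "mip M (f i) w = 0" if "i \<in> S" for i
    proof -
      have "mip M (f i) w = mip M (f i) v - (\<Sum>j\<in>S. mip M (f j) v * mip M (f i) (f j))"
        by (simp add: w_def mip_simps linear_sum[OF mip_linear_right])
      also have "(\<Sum>j\<in>S. mip M (f j) v * mip M (f i) (f j)) = (\<Sum>j\<in>S. if i = j then mip M (f j) v else 0)"
        using f that by (intro sum.cong) auto
      finally show ?thesis using that insert.hyps(1) by simp
    qed
    define e where "e = (1 / sqrt (mip M w w)) *\<^sub>R w"
    have "mip M e e = 1"
      using pw by (simp add: e_def mip_simps)
    moreover have "mip M (f i) e = 0" "mip M e (f i) = 0" if "i \<in> S" for i
      using orth[OF that] mip_commute[OF sym, of "f i" w] by (simp_all add: e_def mip_simps)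
    ultimately have "\<forall>i\<in>insert a S. \<forall>j\<in>insert a S. mip M ((f(a := e)) i) ((f(a := e)) j) = (if i = j then 1 else 0)"
      using f insert.hyps(2) by auto
    then show ?case by blast
  qed
  from this[of UNIV] obtain f :: "'n \<Rightarrow> real ^ 'n"
    where f: "\<And>i j. mip M (f i) (f j) = (if i = j then 1 else 0)" by auto
  define P where "P = (\<chi> i j. f j $ i)"
  have P: "P *v axis j 1 = f j" for j
    by (simp add: P_def vec_eq_iff matrix_vector_mul_component inner_axis)
  have "(transpose P ** M ** P) $ i $ j = mip M (f i) (f j)" for i j
  proof -
    have "(transpose P ** M ** P) $ i $ j = mip (transpose P ** M ** P) (axis i 1) (axis j 1)"
      by (simp only: mip_axis)
    also have "\<dots> = mip M (P *v axis i 1) (P *v axis j 1)"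
      by (rule mip_congruence)
    finally show ?thesis by (simp only: P)
  qed
  then have "transpose P ** M ** P = mat 1"
    by (simp add: vec_eq_iff f mat_def)
  then show thesis by (rule that)
qed

text \<open>In an \<open>M\<close>-orthonormal basis the matrix \<open>C\<close> of \<open>B\<close> is symmetric, so the trace of its square is the
  sum of the squares of its entries.\<close>

lemma trace_square_nonneg:
  fixes M B :: "real ^ 'n ^ 'n::finite"
  assumes sym: "transpose M = M" and pos: "\<And>v. v \<noteq> 0 \<Longrightarrow> mip M v v > 0"
    and self_adjoint: "transpose (M ** B) = M ** B"
  shows "trace (B ** B) \<ge> 0"
proof -
  obtain P :: "real ^ 'n ^ 'n" where P: "transpose P ** M ** P = mat 1"
    using ex_orthonormal_matrix[OF sym pos] by blast
  then have P': "P ** (transpose P ** M) = mat 1"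
    using matrix_left_right_inverse by blast
  define C where "C = transpose P ** (M ** B) ** P"
  have sC: "transpose C = C"
    by (simp only: C_def matrix_transpose_mul[of _ P] matrix_transpose_mul[of "transpose P"]
        self_adjoint transpose_transpose) (simp only: matrix_mul_assoc)
  have "trace (C ** C) = (\<Sum>i\<in>UNIV. \<Sum>j\<in>UNIV. C $ i $ j * C $ j $ i)"
    by (simp add: trace_def matrix_matrix_mult_def)
  also have "\<dots> = (\<Sum>i\<in>UNIV. \<Sum>j\<in>UNIV. (C $ i $ j)\<^sup>2)"
    using sC by (intro sum.cong refl) (simp add: transpose_def vec_eq_iff power2_eq_square)
  finally have "trace (C ** C) \<ge> 0" by (simp add: sum_nonneg)
  moreover have "C ** C = transpose P ** (M ** B) ** (P ** (transpose P ** M)) ** B ** P"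
    by (simp add: C_def matrix_mul_assoc)
  then have "C ** C = transpose P ** (M ** B) ** B ** P"
    unfolding P' by simp
  then have "C ** C = (transpose P ** M) ** (B ** B ** P)"
    by (simp only: matrix_mul_assoc)
  then have "trace (C ** C) = trace ((B ** B ** P) ** (transpose P ** M))"
    using trace_mul_sym[of "transpose P ** M" "B ** B ** P"] by metis
  then have "trace (C ** C) = trace (B ** B ** (P ** (transpose P ** M)))"
    by (simp only: matrix_mul_assoc)
  ultimately show ?thesis by (simp add: P')
qed

locale geodesic_unit_field = riemannian_field U G K
  for U :: "(real ^ 'n::finite) set" and G K +
  assumes unit: "\<And>x. x \<in> U \<Longrightarrow> mip (G x) (K x) (K x) = 1"
    and geodesic: "\<And>x. x \<in> U \<Longrightarrow> nabla G K K x = 0"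
begin

lemma B_K: "x \<in> U \<Longrightarrow> B x *v K x = 0"
  using nabla_eq_B[of x K] geodesic[of x] by simp

text \<open>The length of \<open>K\<close> is constant and the connection is metric.\<close>

lemma mip_B_K:
  assumes x: "x \<in> U"
  shows "mip (G x) (B x *v u) (K x) = 0"
proof -
  have "D (\<lambda>y. mip (G y) (K y) (K y)) x u = D (\<lambda>y. 1) x u"
    by (rule D_cong[OF open_U x unit])
  then have "mip (D G x u) (K x) (K x) + mip (G x) (D K x u) (K x) + mip (G x) (K x) (D K x u) = 0"
    using D_mip[OF diff_G[OF x] diff_K[OF x] diff_K[OF x], of u] by simp
  then show ?thesis
    using koszul_B[OF x, of u "K x"] mip_commute_G[OF x, of "K x" "D K x u"]
      mip_commute_DG[OF x, of "K x" u "K x"] by linarith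
qed

text \<open>Of the two terms of the vorticity, one vanishes because \<open>K\<close> is geodesic and the other because it
  has unit length.\<close>

lemma vorticity_K:
  assumes x: "x \<in> U"
  shows "vorticity G K x *v K x = 0"
proof -
  have "v \<bullet> (vorticity G K x *v K x) = 0" for v
    using mip_vorticity[OF x, of v "K x"] mip_B_K[OF x, of v] B_K[OF x]
    by (simp add: mip_def[of "vorticity G K x"] mip_simps)
  then show ?thesis by (metis inner_eq_zero_iff)
qed

lemma transpose_vorticity: "transpose (vorticity G K x) = - vorticity G K x"
  by (simp add: vorticity_def transpose_def vec_eq_iff)

text \<open>Differentiating \<open>\<Omega>(K, \<cdot>) = 0\<close> expresses the terms \<open>(D\<^sub>u \<Omega>)(K, \<cdot>)\<close> through \<open>\<Omega>\<close> itself, and closedness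
  then expresses \<open>D\<^sub>K \<Omega>\<close> through these terms. This is the vanishing of the Lie derivative of \<open>\<Omega>\<close> along
  \<open>K\<close>, written in coordinates.\<close>

lemma D_vorticity:
  assumes x: "x \<in> U"
  defines "L \<equiv> matrix (D K x)" and "V \<equiv> vorticity G K x"
  shows "D (vorticity G K) x (K x) = transpose (V ** L) - V ** L"
proof (rule matrix_eqI_mip)
  fix v w
  let ?d = "D (vorticity G K) x"
  note diff_V = smooth_on_differentiable[OF smooth_vorticity x]
  have L: "L *v u = D K x u" for u
    using linear_frechet_derivative[OF diff_K[OF x]] by (simp add: L_def matrix_works)
  have tr: "transpose (?d u) = - ?d u" for u
  proof -
    have "transpose (?d u) = D (\<lambda>y. transpose (vorticity G K y)) x u"
      by (rule D_linear[OF bounded_linear_transpose diff_V, symmetric])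
    also have "\<dots> = D (\<lambda>y. - vorticity G K y) x u"
      by (simp only: transpose_vorticity)
    also have "\<dots> = - ?d u"
      by (rule D_linear[OF bounded_linear_minus[OF bounded_linear_ident] diff_V])
    finally show ?thesis .
  qed
  have anti: "mip (?d u) a b = - mip (?d u) b a" for u a b
    using mip_transpose[of "?d u" b a] by (simp add: tr mip_simps)
  have dK: "mip (?d u) a (K x) = - mip V a (L *v u)" for u a
  proof -
    have "D (\<lambda>y. vorticity G K y *v K y) x u = D (\<lambda>y. 0) x u"
      by (rule D_cong[OF open_U x vorticity_K])
    then have "V *v D K x u + ?d u *v K x = 0"
      unfolding V_def by (simp add: D_bilinear[OF bounded_bilinear_matrix_vector diff_V diff_K[OF x]])
    then have "a \<bullet> (V *v D K x u) + a \<bullet> (?d u *v K x) = 0"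
      by (simp flip: inner_add_right)
    then show ?thesis by (simp add: mip_def L)
  qed
  have mul: "mip (V ** L) a b = mip V a (L *v b)" for a b
    by (simp add: mip_def matrix_vector_mul_assoc)
  show "mip (?d (K x)) v w = mip (transpose (V ** L) - V ** L) v w"
    using vorticity_closed[OF x, of "K x" v w] anti[of w "K x" v] dK[of w v] dK[of v w]
    unfolding mip_simps mip_transpose mul by linarith
qed

lemma vorticity_derivative_bound:
  assumes "compact C" "C \<subseteq> U"
  obtains c where "\<And>x. x \<in> C \<Longrightarrow> norm (D (vorticity G K) x (K x)) \<le> c * norm (vorticity G K x)"
proof -
  have "\<exists>b>0. \<forall>(V :: real ^ 'n ^ 'n) (L :: real ^ 'n ^ 'n). norm (V ** L) \<le> norm V * norm L * b"
    by (rule bounded_bilinear.pos_bounded[OF bounded_bilinear_matrix_matrix])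
  then obtain b where b: "b > 0" "\<And>(V :: real ^ 'n ^ 'n) (L :: real ^ 'n ^ 'n). norm (V ** L) \<le> norm V * norm L * b"
    by auto
  have "\<exists>t>0. \<forall>V :: real ^ 'n ^ 'n. norm (transpose V) \<le> norm V * t"
    by (rule bounded_linear.pos_bounded[OF bounded_linear_transpose])
  then obtain t where t: "t > 0" "\<And>V :: real ^ 'n ^ 'n. norm (transpose V) \<le> norm V * t"
    by auto
  have "smooth_on U (\<lambda>x. \<chi> i j. D K x (axis j 1) $ i)"
    by (rule smooth_on_vec[OF open_U smooth_on_vec[OF open_U smooth_on_nth[OF open_U smooth_on_D[OF smooth_K]]]])
  then have "continuous_on C (\<lambda>x. matrix (D K x))"
    using continuous_on_subset[OF smooth_on_continuous assms(2)] by (simp add: matrix_def)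
  then have "bounded ((\<lambda>x. matrix (D K x)) ` C)"
    using compact_continuous_image[OF _ assms(1)] compact_imp_bounded by blast
  then obtain m where m: "m > 0" "\<And>x. x \<in> C \<Longrightarrow> norm (matrix (D K x)) \<le> m"
    by (auto simp: bounded_pos)
  show thesis
  proof (rule that)
    fix x assume x: "x \<in> C"
    let ?V = "vorticity G K x" and ?L = "matrix (D K x)"
    have le: "norm (?V ** ?L) \<le> norm ?V * m * b"
    proof -
      have "norm ?V * norm ?L * b \<le> norm ?V * m * b"
        using m(2)[OF x] b(1) by (intro mult_right_mono mult_left_mono) auto
      then show ?thesis using b(2)[of ?V ?L] by (rule order_trans[rotated])
    qed
    have "norm (D (vorticity G K) x (K x)) \<le> norm (transpose (?V ** ?L)) + norm (?V ** ?L)"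
      using x assms(2) by (subst D_vorticity) (auto intro: norm_triangle_ineq4)
    also have "\<dots> \<le> norm (?V ** ?L) * (t + 1)"
      using t(2)[of "?V ** ?L"] by (simp add: algebra_simps)
    also have "\<dots> \<le> (norm ?V * m * b) * (t + 1)"
      using le t(1) by (intro mult_right_mono) auto
    finally show "norm (D (vorticity G K) x (K x)) \<le> (m * b * (t + 1)) * norm ?V"
      by (simp add: algebra_simps)
  qed
qed

text \<open>In the definition of \<open>R(u, K) K\<close> the term with \<open>\<nabla>\<^sub>K K\<close> drops out; the rest is
  \<open>- (D\<^sub>K B + B\<^sup>2 - L B + B L) u\<close>, where \<open>L\<close> is the coordinate derivative of \<open>K\<close>, and the commutator
  \<open>B L - L B\<close> has trace zero.\<close>

lemma raychaudhuri:
  assumes x: "x \<in> U"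
  shows "D (expansion G K) x (K x) = - ricci G K K x - trace (B x ** B x)"
proof -
  define L where "L = matrix (D K x)"
  note diff_B = smooth_on_differentiable[OF smooth_B x]
  have L: "L *v u = D K x u" for u
    using linear_frechet_derivative[OF diff_K[OF x]] by (simp add: L_def matrix_works)
  have R: "riemann G (\<lambda>_. u) K K x = - ((D B x (K x) + B x ** B x - L ** B x + B x ** L) *v u)" for u
  proof -
    have "D (nabla G K K) x u = D (\<lambda>_. 0) x u"
      by (rule D_cong[OF open_U x geodesic])
    then have 1: "nabla G (\<lambda>_. u) (nabla G K K) x = 0"
      by (simp add: nabla_eq[of G "\<lambda>_. u" "nabla G K K"] geodesic[OF x] linear_0[OF christoffel_vector_linear_right])
    have "D (nabla G (\<lambda>_. u) K) x (K x) = D (\<lambda>y. B y *v u) x (K x)"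
      by (rule D_cong[OF open_U x nabla_eq_B])
    also have "\<dots> = D B x (K x) *v u"
      using D_bilinear[OF bounded_bilinear_matrix_vector diff_B differentiable_const, of u "K x"] by simp
    finally have "nabla G K (nabla G (\<lambda>_. u) K) x = D B x (K x) *v u + christoffel_vector G x (K x) (B x *v u)"
      by (simp add: nabla_eq[of G K] nabla_eq_B[OF x])
    also have "christoffel_vector G x (K x) (B x *v u) = B x *v (B x *v u) - L *v (B x *v u)"
      using B_mult[OF x, of "B x *v u"] by (simp add: L christoffel_vector_commute[OF x, of "K x"])
    finally have 2: "nabla G K (nabla G (\<lambda>_. u) K) x = D B x (K x) *v u + (B x *v (B x *v u) - L *v (B x *v u))" .
    have 3: "nabla G (lie_bracket (\<lambda>_. u) K) K x = B x *v (L *v u)"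
      by (simp add: nabla_eq_B[OF x] lie_bracket_def L)
    show ?thesis
      unfolding riemann_def 1 2 3
      by (simp add: matrix_vector_mult_add_rdistrib matrix_vector_mult_diff_rdistrib matrix_vector_mul_assoc)
  qed
  let ?S = "D B x (K x) + B x ** B x - L ** B x + B x ** L"
  have diagonal: "(A *v axis i 1) $ i = A $ i $ i" for A :: "real ^ 'n ^ 'n" and i
    by (simp add: matrix_vector_mul_component inner_axis)
  have "ricci G K K x = - trace ?S"
    by (simp only: ricci_def R vector_uminus_component diagonal trace_def sum_negf)
  also have "trace ?S = trace (D B x (K x)) + trace (B x ** B x)"
    by (simp add: trace_add trace_sub trace_mul_sym[of L])
  also have "trace (D B x (K x)) = D (expansion G K) x (K x)"
    using D_linear[OF bounded_linear_trace diff_B, of "K x"] by (simp add: expansion_def[abs_def])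
  finally show ?thesis by simp
qed

lemma expansion_decreasing:
  assumes x: "x \<in> U" and "vorticity G K x = 0" and "ricci G K K x > 0"
  shows "D (expansion G K) x (K x) < 0"
proof -
  have "transpose (G x ** B x) = G x ** B x" using assms(2) by (simp add: vorticity_def)
  then have "trace (B x ** B x) \<ge> 0"
    using trace_square_nonneg[OF sym_G[OF x] pos_G[OF x]] by blast
  then show ?thesis using raychaudhuri[OF x] assms(3) by simp
qed

end

section \<open>A minimum principle on an invariant zero set\<close>

text \<open>By the bound \<open>tangent\<close>, \<open>V\<close> vanishes along any integral curve of \<open>k\<close> that starts at a zero of \<open>V\<close>, so
  a function that is minimal over the zero set at \<open>x0\<close> should not decrease along \<open>k\<close> there.
  Instead of following the flow, the constraint is replaced by the penalty \<open>n |V|\<^sup>2\<close>. Any limit \<open>l\<close> of minimisers satisfies \<open>V l = 0\<close>, hence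
  \<open>f x0 \<le> f l\<close>; the extra term \<open>|x - x0|\<^sup>2\<close> then forces \<open>l = x0\<close> and the penalty to tend to zero.\<close>

lemma constrained_minimum:
  fixes f :: "'a::euclidean_space \<Rightarrow> real" and V :: "'a \<Rightarrow> 'b::real_inner" and k :: "'a \<Rightarrow> 'a"
  assumes U: "open U" "x0 \<in> U"
    and f: "\<And>x. x \<in> U \<Longrightarrow> f differentiable (at x)" "continuous_on U (\<lambda>x. D f x (k x))"
    and V: "\<And>x. x \<in> U \<Longrightarrow> V differentiable (at x)" and k: "continuous_on U k"
    and V0: "V x0 = 0" and min: "\<And>x. x \<in> U \<Longrightarrow> V x = 0 \<Longrightarrow> f x0 \<le> f x"
    and tangent: "\<And>x. x \<in> U \<Longrightarrow> norm (D V x (k x)) \<le> c * norm (V x)"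
  shows "D f x0 (k x0) \<ge> 0"
proof (rule ccontr)
  \<comment> \<open>the derivative along \<open>k\<close> of \<open>f + |x - x0|\<^sup>2\<close>\<close>
  define h where "h x = D f x (k x) + 2 * ((x - x0) \<bullet> k x)" for x
  assume "\<not> D f x0 (k x0) \<ge> 0"
  then have h0: "h x0 < 0" by (simp add: h_def)
  have "continuous_on U h"
    unfolding h_def by (intro continuous_intros f k)
  then have "isCont h x0" using U continuous_on_eq_continuous_at by blast
  then obtain d where d: "d > 0" "\<And>x. dist x x0 < d \<Longrightarrow> dist (h x) (h x0) < - h x0 / 2"
    using h0 unfolding continuous_at_eps_delta by (metis half_gt_zero minus_divide_left neg_0_less_iff_less)
  obtain r' where r': "r' > 0" "cball x0 r' \<subseteq> U" using U open_contains_cball by blast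
  define r where "r = min r' (d / 2)"
  have r: "r > 0" "cball x0 r \<subseteq> U" using r' d by (auto simp: r_def)
  have hr: "h x < h x0 / 2" if "x \<in> cball x0 r" for x
    using d(2)[of x] that d(1) by (auto simp: r_def dist_real_def dist_commute abs_less_iff)
  have cf: "continuous_on U f" and cV: "continuous_on U V"
    using f(1) V by (auto intro!: continuous_at_imp_continuous_on differentiable_imp_continuous_within)
  \<comment> \<open>the coefficient is \<open>Suc n\<close> rather than \<open>n\<close> so that it can be divided by\<close>
  define F where "F n x = f x + (x - x0) \<bullet> (x - x0) + real (Suc n) * (V x \<bullet> V x)" for n x
  have "\<exists>x\<in>cball x0 r. \<forall>y\<in>cball x0 r. F n x \<le> F n y" for n
  proof (rule continuous_attains_inf)
    show "continuous_on (cball x0 r) (F n)"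
      unfolding F_def by (intro continuous_intros continuous_on_subset[OF cf] continuous_on_subset[OF cV] r)
  qed (use r in auto)
  then obtain X where X: "\<And>n. X n \<in> cball x0 r" "\<And>n y. y \<in> cball x0 r \<Longrightarrow> F n (X n) \<le> F n y"
    by metis
  obtain l s where l: "l \<in> cball x0 r" and s: "strict_mono s" and lim: "(X \<circ> s) \<longlonglongrightarrow> l"
    using compact_cball[of x0 r] X(1) unfolding compact_def by meson
  define Y where "Y = X \<circ> s"
  have Y: "Y \<longlonglongrightarrow> l" using lim by (simp add: Y_def)
  have lU: "l \<in> U" using l r by auto
  \<comment> \<open>comparing the minimiser with \<open>x0\<close> bounds the penalty at the minimiser by \<open>E\<close>\<close>
  define E where "E x = f x0 - f x - (x - x0) \<bullet> (x - x0)" for x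
  have "isCont E l"
    unfolding E_def using cf lU U(1)
    by (intro continuous_intros) (simp add: continuous_on_eq_continuous_at)
  then have E: "(\<lambda>n. E (Y n)) \<longlonglongrightarrow> E l" using Y isCont_tendsto_compose by blast
  have pen: "real (Suc (s n)) * (V (Y n) \<bullet> V (Y n)) \<le> E (Y n)" for n
    using X(2)[of x0 "s n"] r(1) V0 by (simp add: F_def E_def Y_def)
  have "V (Y n) \<bullet> V (Y n) \<le> E (Y n) * inverse (real (Suc n))" for n
  proof -
    have "real (Suc n) * (V (Y n) \<bullet> V (Y n)) \<le> real (Suc (s n)) * (V (Y n) \<bullet> V (Y n))"
      using seq_suble[OF s, of n] by (intro mult_right_mono) auto
    then have "real (Suc n) * (V (Y n) \<bullet> V (Y n)) \<le> E (Y n)" using pen[of n] by linarith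
    then show ?thesis by (simp add: field_simps)
  qed
  moreover have "(\<lambda>n. E (Y n) * inverse (real (Suc n))) \<longlonglongrightarrow> 0"
    using tendsto_mult[OF E LIMSEQ_inverse_real_of_nat] by simp
  moreover have "(\<lambda>n. V (Y n) \<bullet> V (Y n)) \<longlonglongrightarrow> V l \<bullet> V l"
  proof -
    have "(\<lambda>n. V (Y n)) \<longlonglongrightarrow> V l"
      using Y cV lU U(1) isCont_tendsto_compose continuous_on_eq_continuous_at by blast
    then show ?thesis by (intro tendsto_inner)
  qed
  ultimately have "V l \<bullet> V l \<le> 0" by (meson LIMSEQ_le)
  then have "V l = 0" by (metis inner_ge_zero inner_eq_zero_iff order_antisym)
  then have "f x0 \<le> f l" using min lU by blast
  moreover have "0 \<le> E (Y n)" for n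
  proof -
    have "0 \<le> real (Suc (s n)) * (V (Y n) \<bullet> V (Y n))" by simp
    then show ?thesis using pen[of n] by linarith
  qed
  then have "0 \<le> E l" using E LIMSEQ_le_const by blast
  ultimately have "(l - x0) \<bullet> (l - x0) \<le> 0" by (simp add: E_def)
  then have l0: "l = x0" by (metis inner_ge_zero inner_eq_zero_iff order_antisym right_minus_eq)
  then have "E l = 0" by (simp add: E_def)
  then have "(\<lambda>n. 2 * \<bar>c\<bar> * E (Y n)) \<longlonglongrightarrow> 0" using tendsto_mult_right_zero[of "\<lambda>n. E (Y n)" _ "2 * \<bar>c\<bar>"] E by simp
  then have "\<forall>\<^sub>F n in sequentially. 2 * \<bar>c\<bar> * E (Y n) < - h x0 / 2"
    using h0 by (intro order_tendstoD) auto
  moreover have "\<forall>\<^sub>F n in sequentially. dist (Y n) x0 < r"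
    using Y r(1) l0 tendstoD by blast
  ultimately obtain n where n: "2 * \<bar>c\<bar> * E (Y n) < - h x0 / 2" "dist (Y n) x0 < r"
    using eventually_happens[OF eventually_conj] by (metis (no_types, lifting) sequentially_bot)
  define y where "y = Y n"
  have yb: "y \<in> ball x0 r" using n by (simp add: y_def dist_commute)
  then have yU: "y \<in> U" using r ball_subset_cball by blast
  have "(F (s n) has_derivative (\<lambda>u. D f y u + 2 * ((y - x0) \<bullet> u) + real (Suc (s n)) * (2 * (V y \<bullet> D V y u)))) (at y)"
  proof -
    have "(f has_derivative D f y) (at y)" "(V has_derivative D V y) (at y)"
      using f(1)[OF yU] V[OF yU] by (simp_all add: frechet_derivative_works)
    then show ?thesis
      unfolding F_def[abs_def]
      by (auto intro!: derivative_eq_intros simp: inner_commute algebra_simps)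
  qed
  moreover have "\<forall>z\<in>ball x0 r. F (s n) y \<le> F (s n) z"
    using X(2)[of _ "s n"] by (auto simp: y_def Y_def)
  ultimately have "(\<lambda>u. D f y u + 2 * ((y - x0) \<bullet> u) + real (Suc (s n)) * (2 * (V y \<bullet> D V y u))) = (\<lambda>u. 0)"
    using differential_zero_maxmin[OF yb open_ball] by blast
  then have zero: "h y + real (Suc (s n)) * (2 * (V y \<bullet> D V y (k y))) = 0"
    unfolding h_def by meson
  have "V y \<bullet> D V y (k y) \<le> norm (V y) * norm (D V y (k y))"
    by (rule norm_cauchy_schwarz)
  also have "\<dots> \<le> norm (V y) * (\<bar>c\<bar> * norm (V y))"
    using tangent[OF yU] mult_right_mono[OF abs_ge_self[of c] norm_ge_zero[of "V y"]]
    by (intro mult_left_mono) auto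
  also have "\<dots> = \<bar>c\<bar> * (V y \<bullet> V y)" by (simp add: power2_norm_eq_inner[symmetric] power2_eq_square)
  finally have "real (Suc (s n)) * (2 * (V y \<bullet> D V y (k y))) \<le> real (Suc (s n)) * (2 * (\<bar>c\<bar> * (V y \<bullet> V y)))"
    by (intro mult_left_mono) auto
  also have "\<dots> = 2 * \<bar>c\<bar> * (real (Suc (s n)) * (V y \<bullet> V y))" by simp
  also have "\<dots> \<le> 2 * \<bar>c\<bar> * E y"
    using pen[of n] by (intro mult_left_mono) (auto simp: y_def)
  finally have "real (Suc (s n)) * (2 * (V y \<bullet> D V y (k y))) < - h x0 / 2" using n(1) by (simp add: y_def)
  then show False using zero hr[of y] yb by simp
qed

section \<open>Change of chart\<close>

text \<open>The situation on the overlap of two charts: \<open>\<phi>\<close> is the transition map, defined on \<open>W\<close>, and carries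
  the metric and the vector field of the first chart to those of the second.\<close>

locale chart_change =
  S: riemannian_field U G K + T: riemannian_field U' G' K'
  for U :: "(real ^ 'n::finite) set" and G K and U' :: "(real ^ 'n) set" and G' K' +
  fixes W :: "(real ^ 'n) set" and \<phi> :: "real ^ 'n \<Rightarrow> real ^ 'n"
  assumes open_W: "open W" and WU: "W \<subseteq> U" and smooth_\<phi>: "smooth_on W \<phi>"
    and \<phi>U: "\<And>x. x \<in> W \<Longrightarrow> \<phi> x \<in> U'"
    and K'_\<phi>: "\<And>x. x \<in> W \<Longrightarrow> K' (\<phi> x) = D \<phi> x (K x)"
    and G_\<phi>: "\<And>x v w. x \<in> W \<Longrightarrow> mip (G x) v w = mip (G' (\<phi> x)) (D \<phi> x v) (D \<phi> x w)"
begin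

abbreviation J where "J x \<equiv> matrix (D \<phi> x)"

lemma J_mult: "x \<in> W \<Longrightarrow> J x *v v = D \<phi> x v"
  using linear_frechet_derivative[OF smooth_on_differentiable[OF smooth_\<phi>]] by (simp add: matrix_works)

lemma G_J: "x \<in> W \<Longrightarrow> mip (G x) v w = mip (G' (\<phi> x)) (J x *v v) (J x *v w)"
  by (simp only: G_\<phi> J_mult)

lemma smooth_J: "smooth_on W J"
  unfolding matrix_def
  by (rule smooth_on_vec[OF open_W smooth_on_vec[OF open_W smooth_on_nth[OF open_W smooth_on_D[OF smooth_\<phi>]]]])

lemma D_J_mult:
  assumes x: "x \<in> W"
  shows "D (\<lambda>y. J y *v v) x u = D J x u *v v"
  using D_bilinear[OF bounded_bilinear_matrix_vector smooth_on_differentiable[OF smooth_J x] differentiable_const, of v u]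
  by simp

lemma D_J_commute:
  assumes x: "x \<in> W"
  shows "D J x u *v v = D J x v *v u"
proof -
  have "D (\<lambda>y. J y *v v) x u = D (\<lambda>y. D \<phi> y v) x u" for u v
    by (rule D_cong[OF open_W x J_mult])
  then show ?thesis
    using symmetric_second_derivative[OF open_W x smooth_\<phi>, of v u] D_J_mult[OF x] by simp
qed

text \<open>The differential preserves lengths, so it is injective.\<close>

lemma invertible_J:
  assumes x: "x \<in> W"
  shows "invertible (J x)"
proof -
  have "J x *v v = 0 \<longrightarrow> v = 0" for v
    using S.pos_G[of x v] G_J[OF x, of v v] WU x by (cases "v = 0") (auto simp: mip_simps)
  then show ?thesis by (simp add: invertible_left_inverse matrix_left_invertible_ker)
qed

lemma J_surj:
  assumes x: "x \<in> W"
  obtains v where "J x *v v = w"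
proof
  show "J x *v (matrix_inv (J x) *v w) = w"
    using matrix_inv_both[OF invertible_J[OF x]] by (simp add: matrix_vector_mul_assoc)
qed

text \<open>Both sides are determined by the Koszul formula. Differentiating the transformation laws of the
  metric and of the field produces second derivatives of \<open>\<phi>\<close>; by their symmetry all of them cancel.\<close>

lemma B_J:
  assumes x: "x \<in> W"
  shows "T.B (\<phi> x) *v (J x *v u) = J x *v (S.B x *v u)"
proof (rule T.mip_G_eqD[OF \<phi>U[OF x]])
  fix w'
  obtain w where w: "J x *v w = w'" using J_surj[OF x] by blast
  have xU: "x \<in> U" using x WU by blast
  let ?G' = "G' (\<phi> x)" and ?DG' = "\<lambda>v. D G' (\<phi> x) (J x *v v)"
  have d\<phi>: "(\<phi> has_derivative D \<phi> x) (at x)" by (rule smooth_on_has_derivative[OF smooth_\<phi> x])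
  have G'\<phi>: "((\<lambda>y. G' (\<phi> y)) has_derivative (\<lambda>u. D G' (\<phi> x) (D \<phi> x u))) (at x)"
    by (rule has_derivative_compose[OF d\<phi> smooth_on_has_derivative[OF T.smooth_G \<phi>U[OF x]]])
  have K'\<phi>: "((\<lambda>y. K' (\<phi> y)) has_derivative (\<lambda>u. D K' (\<phi> x) (D \<phi> x u))) (at x)"
    by (rule has_derivative_compose[OF d\<phi> smooth_on_has_derivative[OF T.smooth_K \<phi>U[OF x]]])
  have Jv: "(\<lambda>y. J y *v v) differentiable (at x)" for v
    by (rule smooth_on_differentiable[OF smooth_on_bilinear[OF open_W bounded_bilinear_matrix_vector smooth_J smooth_on_const] x])
  have DG: "mip (D G x u) v w = mip (?DG' u) (J x *v v) (J x *v w)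
      + mip ?G' (D J x u *v v) (J x *v w) + mip ?G' (J x *v v) (D J x u *v w)" for u v w
  proof -
    have "mip (D G x u) v w = D (\<lambda>y. mip (G y) v w) x u"
      using D_mip[OF S.diff_G[OF xU] differentiable_const differentiable_const, of v w u] by (simp add: mip_simps)
    also have "\<dots> = D (\<lambda>y. mip (G' (\<phi> y)) (J y *v v) (J y *v w)) x u"
      by (rule D_cong[OF open_W x]) (simp add: G_\<phi> J_mult)
    also have "\<dots> = mip (?DG' u) (J x *v v) (J x *v w)
      + mip ?G' (D J x u *v v) (J x *v w) + mip ?G' (J x *v v) (D J x u *v w)"
      using D_mip[OF differentiableI[OF G'\<phi>] Jv Jv, of v w u] D_eqI[OF G'\<phi>, of u]
      by (simp add: D_J_mult[OF x] J_mult[OF x])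
    finally show ?thesis .
  qed
  have DK: "D K' (\<phi> x) (J x *v u) = J x *v D K x u + D J x u *v K x" for u
  proof -
    have "D K' (\<phi> x) (J x *v u) = D (\<lambda>y. K' (\<phi> y)) x u"
      using D_eqI[OF K'\<phi>, of u] by (simp add: J_mult[OF x])
    also have "\<dots> = D (\<lambda>y. J y *v K y) x u"
      by (rule D_cong[OF open_W x]) (simp add: K'_\<phi> J_mult)
    also have "\<dots> = J x *v D K x u + D J x u *v K x"
      by (rule D_bilinear[OF bounded_bilinear_matrix_vector smooth_on_differentiable[OF smooth_J x] S.diff_K[OF xU]])
    finally show ?thesis .
  qed
  have K': "K' (\<phi> x) = J x *v K x" using K'_\<phi>[OF x] J_mult[OF x] by simp
  note commute = T.mip_commute_G[OF \<phi>U[OF x]]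
  have "2 * mip ?G' (T.B (\<phi> x) *v (J x *v u)) (J x *v w) =
      2 * mip ?G' (J x *v D K x u) (J x *v w) + 2 * mip ?G' (D J x u *v K x) (J x *v w)
      + mip (?DG' u) (J x *v K x) (J x *v w) + mip (?DG' (K x)) (J x *v u) (J x *v w)
      - mip (?DG' w) (J x *v u) (J x *v K x)"
    by (simp only: T.koszul_B[OF \<phi>U[OF x]] DK K' mip_simps distrib_left)
  also have "\<dots> = 2 * mip (G x) (D K x u) w + mip (D G x u) (K x) w + mip (D G x (K x)) u w
      - mip (D G x w) u (K x)"
    unfolding DG D_J_commute[OF x, of "K x" u] D_J_commute[OF x, of w "K x"] D_J_commute[OF x, of w u]
      commute[of "J x *v K x" "D J x u *v w"] G_J[OF x, of "D K x u"]
    by simp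
  also have "\<dots> = 2 * mip (G x) (S.B x *v u) w"
    by (rule S.koszul_B[OF xU, symmetric])
  finally have "2 * mip ?G' (T.B (\<phi> x) *v (J x *v u)) (J x *v w) = 2 * mip (G x) (S.B x *v u) w" .
  then show "mip ?G' (T.B (\<phi> x) *v (J x *v u)) w' = mip ?G' (J x *v (S.B x *v u)) w'"
    by (simp add: G_J[OF x] w)
qed

lemma expansion_invariant:
  assumes x: "x \<in> W"
  shows "expansion G' K' (\<phi> x) = expansion G K x"
proof -
  note inv = matrix_inv_both[OF invertible_J[OF x]]
  have "T.B (\<phi> x) ** J x = J x ** S.B x"
    using B_J[OF x] by (simp add: matrix_eq matrix_vector_mul_assoc)
  then have "T.B (\<phi> x) ** (J x ** matrix_inv (J x)) = (J x ** S.B x) ** matrix_inv (J x)"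
    by (simp add: matrix_mul_assoc)
  then have "trace (T.B (\<phi> x)) = trace ((J x ** S.B x) ** matrix_inv (J x))"
    by (simp add: inv)
  also have "\<dots> = trace (matrix_inv (J x) ** (J x ** S.B x))" by (rule trace_mul_sym)
  also have "\<dots> = trace (S.B x)" by (simp add: matrix_mul_assoc inv)
  finally show ?thesis by (simp add: expansion_def)
qed

lemma vorticity_pullback:
  assumes x: "x \<in> W"
  shows "mip (vorticity G K x) v u = mip (vorticity G' K' (\<phi> x)) (J x *v v) (J x *v u)"
proof -
  have xU: "x \<in> U" using x WU by blast
  have "mip (G' (\<phi> x)) (T.B (\<phi> x) *v (J x *v u)) (J x *v v) = mip (G x) (S.B x *v u) v" for u v
    by (simp only: G_J[OF x] B_J[OF x])
  then show ?thesis
    by (simp add: S.mip_vorticity[OF xU] T.mip_vorticity[OF \<phi>U[OF x]])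
qed

lemma vorticity_zero:
  assumes x: "x \<in> W" and "vorticity G' K' (\<phi> x) = 0"
  shows "vorticity G K x = 0"
  by (rule matrix_eqI_mip) (simp add: vorticity_pullback[OF x] assms(2) mip_simps)

end

section \<open>Rotation and vorticity in dimension three\<close>

lemma (in geodesic_unit_field) mip_vorticity_eq_rotation:
  fixes X Y :: "real ^ 'n \<Rightarrow> real ^ 'n"
  assumes x: "x \<in> U"
  shows "mip (vorticity G K x) (X x) (Y x) = mip (G x) (nabla G Y K x) (X x) - mip (G x) (nabla G X K x) (Y x)"
  by (simp add: mip_vorticity[OF x] nabla_eq_B[OF x])

text \<open>The rotation is the component of the vorticity on the pair \<open>X\<close>, \<open>Y\<close>. The components involving \<open>K\<close>
  vanish, and in dimension three no others remain.\<close>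

lemma vorticity_zero_if_rotation_zero:
  fixes U :: "(real ^ 3) set"
  assumes "geodesic_unit_field U G K" and x: "x \<in> U"
    and frame: "mip (G x) (X x) (X x) = 1" "mip (G x) (Y x) (Y x) = 1"
      "mip (G x) (K x) (X x) = 0" "mip (G x) (K x) (Y x) = 0" "mip (G x) (X x) (Y x) = 0"
    and rot: "rotation G K X Y x = 0"
  shows "vorticity G K x = 0"
proof -
  interpret geodesic_unit_field U G K by fact
  let ?V = "vorticity G K x"
  define e :: "3 \<Rightarrow> real ^ 3" where "e = (\<lambda>j. if j = 1 then K x else if j = 2 then X x else Y x)"
  define P :: "real ^ 3 ^ 3" where "P = (\<chi> i j. e j $ i)"
  have e: "e 1 = K x" "e 2 = X x" "e 3 = Y x" by (simp_all add: e_def)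
  have P: "P *v axis j 1 = e j" for j
    by (simp add: P_def vec_eq_iff matrix_vector_mul_component inner_axis)
  have entry: "(transpose P ** M ** P) $ i $ j = mip M (e i) (e j)" for M i j
    by (metis P mip_axis mip_congruence)
  have "mip (G x) (e i) (e j) = (if i = j then 1 else 0)" for i j
    using exhaust_3[of i] exhaust_3[of j] frame unit[OF x]
      mip_commute_G[OF x, of "X x" "K x"] mip_commute_G[OF x, of "Y x" "K x"] mip_commute_G[OF x, of "Y x" "X x"]
    by (auto simp: e)
  then have "transpose P ** G x ** P = mat 1"
    by (simp add: vec_eq_iff entry mat_def)
  then have P': "P ** (transpose P ** G x) = mat 1"
    using matrix_left_right_inverse by blast
  have anti: "mip ?V a b = - mip ?V b a" for a b
    using mip_transpose[of ?V b a] by (simp add: transpose_vorticity mip_simps)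
  have VK: "mip ?V a (K x) = 0" for a
    by (simp add: mip_def vorticity_K[OF x])
  have VXY: "mip ?V (X x) (Y x) = 0"
    using rot mip_vorticity_eq_rotation[OF x, of X Y] by (simp add: rotation_def)
  have "mip ?V (e i) (e j) = 0" for i j
    using exhaust_3[of i] exhaust_3[of j] VK VXY anti[of "K x"] anti[of "Y x" "X x"]
      anti[of "X x" "X x"] anti[of "Y x" "Y x"]
    by (auto simp: e)
  then have zero: "transpose P ** ?V ** P = 0"
    by (simp add: vec_eq_iff entry)
  have onto: "v = P *v ((transpose P ** G x) *v v)" for v
    by (simp only: matrix_vector_mul_assoc P' matrix_vector_mul_lid)
  have "mip ?V v w = 0" for v w
    using mip_congruence[of P ?V "(transpose P ** G x) *v v" "(transpose P ** G x) *v w"] onto[of v] onto[of w]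
    by (simp add: zero mip_simps)
  then show ?thesis by (intro matrix_eqI_mip) (simp add: mip_simps)
qed

section \<open>The minimum of the expansion over the vorticity-free points\<close>

text \<open>The functions \<open>f i\<close> glue to a continuous function, and the zero sets of the \<open>V i\<close> to a closed, hence
  compact set. The minimum is reported in a patch around the minimum point, where the local
  principle applies.\<close>

lemma minimum_on_zero_set:
  fixes V :: "'i \<Rightarrow> 'm \<Rightarrow> 'b::{t2_space,zero}" and f :: "'i \<Rightarrow> 'm \<Rightarrow> real"
  assumes M: "compact_space M"
    and T: "\<And>i. i \<in> I \<Longrightarrow> openin M (T i)" "(\<Union>i\<in>I. T i) = topspace M"
    and V: "\<And>i. i \<in> I \<Longrightarrow> continuous_map (subtopology M (T i)) euclidean (V i)"
    and f: "\<And>i. i \<in> I \<Longrightarrow> continuous_map (subtopology M (T i)) euclideanreal (f i)"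
    and V_indep: "\<And>i j p. i \<in> I \<Longrightarrow> j \<in> I \<Longrightarrow> p \<in> T i \<inter> T j \<Longrightarrow> V i p = 0 \<Longrightarrow> V j p = 0"
    and f_indep: "\<And>i j p. i \<in> I \<Longrightarrow> j \<in> I \<Longrightarrow> p \<in> T i \<inter> T j \<Longrightarrow> f i p = f j p"
    and zero: "i0 \<in> I" "p0 \<in> T i0" "V i0 p0 = 0"
  obtains i p where "i \<in> I" "p \<in> T i" "V i p = 0"
    "\<And>q. q \<in> T i \<Longrightarrow> V i q = 0 \<Longrightarrow> f i p \<le> f i q"
proof -
  define ix where "ix p = (SOME i. i \<in> I \<and> p \<in> T i)" for p
  have ix: "ix p \<in> I" "p \<in> T (ix p)" if "i \<in> I" "p \<in> T i" for i p
    using someI[of "\<lambda>i. i \<in> I \<and> p \<in> T i" i] that by (auto simp: ix_def)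
  define F where "F p = f (ix p) p" for p
  have F: "F p = f i p" if "i \<in> I" "p \<in> T i" for i p
    using f_indep[of "ix p" i p] ix[OF that] that by (simp add: F_def)
  have contF: "continuous_map M euclideanreal F"
  proof (rule pasting_lemma[where I = I and T = T and f = f])
    show "\<exists>j. j \<in> I \<and> p \<in> T j \<and> F p = f j p" if "p \<in> topspace M" for p
      using that T(2) F by blast
    show "f i p = f j p" if "i \<in> I" "j \<in> I" "p \<in> topspace M \<inter> T i \<inter> T j" for i j p
      using f_indep[OF that(1,2), of p] that(3) by blast
  qed (fact T(1) f)+
  define N where "N = (\<Union>i\<in>I. {p \<in> T i. V i p \<noteq> 0})"
  have "openin M {p \<in> T i. V i p \<noteq> 0}" if "i \<in> I" for i
  proof -
    have "openin (subtopology M (T i)) {p \<in> topspace (subtopology M (T i)). V i p \<in> - {0}}"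
      using V[OF that] by (rule openin_continuous_map_preimage) auto
    moreover have "topspace (subtopology M (T i)) = T i"
      using openin_subset[OF T(1)[OF that]] by auto
    ultimately show ?thesis using T(1)[OF that] openin_trans_full by fastforce
  qed
  then have "openin M N" unfolding N_def by blast
  then have "closedin M (topspace M - N)" by blast
  then have "compactin M (topspace M - N)" by (rule closedin_compact_space[OF M])
  then have "compact (F ` (topspace M - N))"
    using image_compactin[OF _ contF] by simp
  moreover have N: "p \<in> topspace M - N \<longleftrightarrow> V i p = 0" if "i \<in> I" "p \<in> T i" for i p
    using that V_indep[of i _ p] T(2) by (auto simp: N_def)
  then have "p0 \<in> topspace M - N" using zero by blast
  then have "F ` (topspace M - N) \<noteq> {}" by blast
  ultimately obtain p where p: "p \<in> topspace M - N" "\<And>q. q \<in> topspace M - N \<Longrightarrow> F p \<le> F q"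
    using compact_attains_inf[of "F ` (topspace M - N)"] by blast
  obtain i where i: "i \<in> I" "p \<in> T i" using p(1) T(2) by blast
  show thesis
  proof (rule that[OF i])
    show "V i p = 0" using N[OF i] p(1) by blast
    show "f i p \<le> f i q" if "q \<in> T i" "V i q = 0" for q
      using p(2)[of q] N[of i q] F[of i] i that by simp
  qed
qed

lemma chart_change_transition:
  assumes A: "smooth_atlas M A" and g: "riemannian_metric A g"
    and k: "smooth_vector_field A k" and c: "c \<in> A" and c': "c' \<in> A"
  shows "chart_change (crange c) (g c) (k c) (crange c') (g c') (k c')
    (coord c ` (cdom c \<inter> cdom c')) (transition c c')"
    and "\<And>p. p \<in> cdom c \<Longrightarrow> transition c c' (coord c p) = coord c' p"
proof -
  have ch: "chart_on M b" if "b \<in> A" for b using A that by (simp add: smooth_atlas_def)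
  have rf: "riemannian_field (crange b) (g b) (k b)" if "b \<in> A" for b
  proof
    show "open (crange b)" using ch[OF that] by (simp add: chart_on_def)
    show "smooth_on (crange b) (g b)" using g that unfolding riemannian_metric_def by blast
    show "smooth_on (crange b) (k b)" using k that unfolding smooth_vector_field_def by blast
    show "transpose (g b x) = g b x" if "x \<in> crange b" for x
      using g \<open>b \<in> A\<close> that unfolding riemannian_metric_def by blast
    show "mip (g b x) v v > 0" if "x \<in> crange b" "v \<noteq> 0" for x v
      using g \<open>b \<in> A\<close> that unfolding riemannian_metric_def by blast
  qed
  have dom: "topspace (subtopology M (cdom c)) = cdom c"
    using ch[OF c] openin_subset by (fastforce simp: chart_on_def)
  have hom: "homeomorphic_map (subtopology M (cdom c)) (top_of_set (crange c)) (coord c)"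
    using ch[OF c] by (simp add: chart_on_def)
  have "inj_on (coord c) (cdom c)"
    using homeomorphic_imp_injective_map[OF hom] dom by simp
  then show tr: "transition c c' (coord c p) = coord c' p" if "p \<in> cdom c" for p
    using that by (simp add: transition_def)
  have "openin (top_of_set (crange c)) (coord c ` (cdom c \<inter> cdom c'))"
  proof -
    have "openin (subtopology M (cdom c)) (cdom c \<inter> cdom c')"
      using ch[OF c'] by (auto simp: openin_subtopology chart_on_def)
    then show ?thesis
      using homeomorphic_imp_open_map[OF hom] by (simp add: open_map_def)
  qed
  then have op: "open (coord c ` (cdom c \<inter> cdom c'))"
    using ch[OF c] openin_open_trans by (auto simp: chart_on_def)
  interpret S: riemannian_field "crange c" "g c" "k c" by (rule rf[OF c])
  interpret T: riemannian_field "crange c'" "g c'" "k c'" by (rule rf[OF c'])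
  show "chart_change (crange c) (g c) (k c) (crange c') (g c') (k c')
    (coord c ` (cdom c \<inter> cdom c')) (transition c c')"
  proof
    show "smooth_on (coord c ` (cdom c \<inter> cdom c')) (transition c c')"
      using A c c' by (simp add: smooth_atlas_def)
    show "open (coord c ` (cdom c \<inter> cdom c'))" by (rule op)
    show "coord c ` (cdom c \<inter> cdom c') \<subseteq> crange c" by blast
    fix x assume "x \<in> coord c ` (cdom c \<inter> cdom c')"
    then obtain p where p: "p \<in> cdom c \<inter> cdom c'" and x: "x = coord c p" by blast
    then have \<phi>: "transition c c' x = coord c' p" using tr by blast
    show "transition c c' x \<in> crange c'" unfolding \<phi> using p by blast
    show "k c' (transition c c' x) = D (transition c c') x (k c x)"
      unfolding \<phi> unfolding x using k c c' p unfolding smooth_vector_field_def by blast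
    show "mip (g c x) v w = mip (g c' (transition c c' x)) (D (transition c c') x v) (D (transition c c') x w)" for v w
      unfolding \<phi> unfolding x using g c c' p unfolding riemannian_metric_def by blast
  qed
qed

theorem corollary1:
  fixes M :: "'m topology"
    and A :: "('m, 3) chart set"
    and g :: "('m, 3) chart \<Rightarrow> real ^ 3 \<Rightarrow> real ^ 3 ^ 3"
    and k :: "('m, 3) chart \<Rightarrow> real ^ 3 \<Rightarrow> real ^ 3"
  assumes "closed_smooth_manifold M A"
    and "riemannian_metric A g"
    and "smooth_vector_field A k"
    and "unit_field A g k"
    and "geodesic_field A g k"
    and "\<forall>c\<in>A. \<forall>x\<in>crange c. ricci (g c) (k c) (k c) x > 0"
  shows "\<forall>q\<in>topspace M. \<not> hypersurface_orthogonal_at A g k q"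
proof (intro ballI notI)
  fix q assume "q \<in> topspace M" and "hypersurface_orthogonal_at A g k q"
  have atlas: "smooth_atlas M A" and compact: "compact_space M"
    using assms(1) by (auto simp: closed_smooth_manifold_def)
  note change = chart_change_transition[OF atlas assms(2,3)]
  have guf: "geodesic_unit_field (crange c) (g c) (k c)" if c: "c \<in> A" for c
  proof -
    interpret chart_change "crange c" "g c" "k c" "crange c" "g c" "k c"
      "coord c ` (cdom c \<inter> cdom c)" "transition c c" by (rule change(1)[OF c c])
    show ?thesis
      by unfold_locales (use assms(4,5) c in \<open>auto simp: unit_field_def geodesic_field_def\<close>)
  qed
  have coord: "continuous_map (subtopology M (cdom c)) (top_of_set (crange c)) (coord c)" if "c \<in> A" for c
    using atlas that by (auto simp: smooth_atlas_def chart_on_def homeomorphic_imp_continuous_map)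
  define V where "V c p = vorticity (g c) (k c) (coord c p)" for c p
  define f where "f c p = expansion (g c) (k c) (coord c p)" for c p
  obtain c0 where c0: "c0 \<in> A" "q \<in> cdom c0" "V c0 q = 0"
  proof -
    obtain c W X Y where c: "c \<in> A" "q \<in> cdom c" and W: "coord c q \<in> W"
      and frame: "local_orthonormal_frame (g c) W (k c) X Y"
      and rot: "rotation (g c) (k c) X Y (coord c q) = 0"
      using \<open>hypersurface_orthogonal_at A g k q\<close> unfolding hypersurface_orthogonal_at_def by blast
    have "vorticity (g c) (k c) (coord c q) = 0"
      using frame W c by (intro vorticity_zero_if_rotation_zero[OF guf[OF c(1)] _ _ _ _ _ _ rot])
        (auto simp: local_orthonormal_frame_def)
    then show thesis using that c by (simp add: V_def)
  qed
  obtain c p where c: "c \<in> A" and p: "p \<in> cdom c" and Vp: "V c p = 0"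
    and min: "\<And>q. q \<in> cdom c \<Longrightarrow> V c q = 0 \<Longrightarrow> f c p \<le> f c q"
  proof (rule minimum_on_zero_set[OF compact, of A cdom V f c0 q])
    fix c assume c: "c \<in> A"
    interpret geodesic_unit_field "crange c" "g c" "k c" by (rule guf[OF c])
    show "openin M (cdom c)" using atlas c by (simp add: smooth_atlas_def chart_on_def)
    show "continuous_map (subtopology M (cdom c)) euclidean (V c)"
      using continuous_map_compose[OF coord[OF c], of euclidean "vorticity (g c) (k c)"]
        smooth_on_continuous[OF smooth_vorticity] by (simp add: V_def[abs_def] o_def)
    show "continuous_map (subtopology M (cdom c)) euclideanreal (f c)"
      using continuous_map_compose[OF coord[OF c], of euclidean "expansion (g c) (k c)"]
        smooth_on_continuous[OF smooth_expansion] by (simp add: f_def[abs_def] o_def)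
  next
    fix c c' p assume cc: "c \<in> A" "c' \<in> A" and p: "p \<in> cdom c \<inter> cdom c'"
    show "V c' p = 0" if "V c p = 0"
      using chart_change.vorticity_zero[OF change(1)[OF cc(2,1)], of "coord c' p"] change(2)[OF cc(2,1), of p] p that
      by (auto simp: V_def)
    show "f c p = f c' p"
      using chart_change.expansion_invariant[OF change(1)[OF cc], of "coord c p"] change(2)[OF cc, of p] p
      by (auto simp: f_def)
  qed (use atlas c0 in \<open>auto simp: smooth_atlas_def\<close>)
  interpret geodesic_unit_field "crange c" "g c" "k c" by (rule guf[OF c])
  define x0 where "x0 = coord c p"
  have x0: "x0 \<in> crange c" using p by (simp add: x0_def)
  then obtain r where r: "r > 0" "cball x0 r \<subseteq> crange c"
    using open_U open_contains_cball by blast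
  then have ball: "ball x0 r \<subseteq> crange c" using ball_subset_cball by blast
  obtain b where b: "\<And>x. x \<in> cball x0 r \<Longrightarrow>
      norm (D (vorticity (g c) (k c)) x (k c x)) \<le> b * norm (vorticity (g c) (k c) x)"
    using vorticity_derivative_bound[OF compact_cball r(2)] by blast
  have "D (expansion (g c) (k c)) x0 (k c x0) \<ge> 0"
  proof (rule constrained_minimum[where U = "ball x0 r" and V = "vorticity (g c) (k c)" and c = b])
    show "continuous_on (ball x0 r) (\<lambda>x. D (expansion (g c) (k c)) x (k c x))"
      by (rule continuous_on_subset[OF smooth_on_continuous[OF smooth_D_along[OF smooth_expansion]] ball])
    show "continuous_on (ball x0 r) (k c)"
      by (rule continuous_on_subset[OF smooth_on_continuous[OF smooth_K] ball])
    show "expansion (g c) (k c) x0 \<le> expansion (g c) (k c) x"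
      if "x \<in> ball x0 r" "vorticity (g c) (k c) x = 0" for x
    proof -
      have "x \<in> crange c" using that(1) ball by blast
      then obtain y where "y \<in> cdom c" "x = coord c y" by blast
      then show ?thesis using min[of y] that(2) by (simp add: V_def f_def x0_def)
    qed
    show "vorticity (g c) (k c) x0 = 0" using Vp by (simp add: V_def x0_def)
  qed (use ball r b smooth_on_differentiable[OF smooth_expansion] smooth_on_differentiable[OF smooth_vorticity] in auto)
  moreover have "vorticity (g c) (k c) x0 = 0" using Vp by (simp add: V_def x0_def)
  then have "D (expansion (g c) (k c)) x0 (k c x0) < 0"
    using expansion_decreasing[OF x0] assms(6) c x0 by blast
  ultimately show False by simp
qed

end
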